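(* Let $n\ge2$ be an integer, $a_0,\dots,a_{n+1}\in\mathbb{C}$, and $H(x,y)=xy+H_{n+1}(x,y)$ with $H_{n+1}(x,y)=\sum_{j=0}^{n+1}a_jx^{n+1-j}y^j$. Assume $a_ja_k\neq0$ for two integers $j,k$ such that $0\le j<\frac{n+1}{2}<k\le n+1$. Let $h\in\mathbb{C}$ and let $\mathrm{P}\in\overline{L}_h$ be a point at infinity. Then $\lambda^h_{\mathrm{P}}(H)\neq0$ if and only if $h=0$ and $\mathrm{P}=[1:0:0]$ or $\mathrm{P}=[0:1:0]$ with multiplicity $N$ such that $1<N<\frac{n+1}{2}$.
   Context: $L_h=\{(x,y)\in\mathbb{C}^2:H(x,y)=h\}$ and $\overline{L}_h$ is its projective closure in $\mathbb{CP}^2$ with homogeneous coordinates $[x:y:z]$; the points at infinity are those with $z=0$, i.e. the points of $\overline{L}_h-L_h$. Writing $H_{n+1}(x,y)=\prod_{j=1}^m(\alpha_jx-\beta_jy)^{n_j}$ with pairwise non-proportional linear factors and $n_j\ge1$, the points at infinity are $[\beta_j:\alpha_j:0]$, and $n_j$ is called the multiplicity of $[\beta_j:\alpha_j:0]$. For generic $h'$ let $\tau_{h'}:L_{h'}\to\mathbb{C}$, $\tau_{h'}(x,y)=x$; its ramification points are the points $(x_0,y_0)\in L_{h'}$ with $H_y(x_0,y_0)=0$. For a point $\mathrm{P}\in\overline{L}_h-L_h$, $\lambda^h_{\mathrm{P}}(H)$ denotes the number of ramification points of $\tau_{h'}$ on $L_{h'}$ which tend to $\mathrm{P}$ (in $\mathbb{CP}^2$)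 as $h'$ tends to $h$. *)

theory Defs
  imports "HOL-Analysis.Analysis"
begin

definition proportional :: "complex^3 \<Rightarrow> complex^3 \<Rightarrow> bool" where
  "proportional u v \<longleftrightarrow> u \<noteq> 0 \<and> (\<exists>c. c \<noteq> 0 \<and> v = c *s u)"

lemma part_equivp_proportional: "part_equivp proportional"
proof (rule part_equivpI)
  show "\<exists>u. proportional u u"
    by (rule exI[of _ "axis 1 1"], auto simp: proportional_def axis_eq_0_iff intro!: exI[of _ 1])
  show "symp proportional"
  proof (rule sympI)
    fix u v assume "proportional u v"
    then obtain c where c: "u \<noteq> 0" "c \<noteq> 0" "v = c *s u"
      by (auto simp: proportional_def)
    then have "u = inverse c *s v" "v \<noteq> 0"
      by (auto simp: vector_smult_assoc)
    with c(2) show "proportional v u"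
      unfolding proportional_def by (metis inverse_zero_imp_zero)
  qed
  show "transp proportional"
  proof (rule transpI)
    fix u v w assume "proportional u v" "proportional v w"
    then obtain c d where "u \<noteq> 0" "c \<noteq> 0" "d \<noteq> 0" "w = (d * c) *s u"
      by (auto simp: proportional_def vector_smult_assoc)
    then show "proportional u w"
      unfolding proportional_def by (metis mult_eq_0_iff)
  qed
qed

text \<open>The complex projective plane, with the quotient topology of \<open>\<complex>\<^sup>3 - {0}\<close>.
  The zero vector lies outside the domain of the partial equivalence relation.\<close>

quotient_type cp2 = "complex^3" / partial: proportional
  by (rule part_equivp_proportional)

instantiation cp2 :: topological_space
begin

definition open_cp2 :: "cp2 set \<Rightarrow> bool" where
  "open_cp2 U \<longleftrightarrow> open {v. v \<noteq> 0 \<and> abs_cp2 v \<in> U}"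

instance
proof
  show "open (UNIV :: cp2 set)"
  proof -
    have "open (- {0 :: complex^3})" by (intro open_Compl closed_singleton)
    then show ?thesis by (simp add: open_cp2_def Compl_eq)
  qed
next
  fix S T :: "cp2 set" assume "open S" "open T"
  then have "open ({v. v \<noteq> 0 \<and> abs_cp2 v \<in> S} \<inter> {v. v \<noteq> 0 \<and> abs_cp2 v \<in> T})"
    unfolding open_cp2_def by (rule open_Int)
  moreover have "{v. v \<noteq> 0 \<and> abs_cp2 v \<in> S} \<inter> {v. v \<noteq> 0 \<and> abs_cp2 v \<in> T}
      = {v. v \<noteq> 0 \<and> abs_cp2 v \<in> S \<inter> T}" by auto
  ultimately show "open (S \<inter> T)" by (simp add: open_cp2_def)
next
  fix K :: "cp2 set set" assume "\<forall>S\<in>K. open S"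
  then have "open (\<Union>S\<in>K. {v. v \<noteq> 0 \<and> abs_cp2 v \<in> S})"
    unfolding open_cp2_def by (intro open_UN)
  moreover have "(\<Union>S\<in>K. {v. v \<noteq> 0 \<and> abs_cp2 v \<in> S}) = {v. v \<noteq> 0 \<and> abs_cp2 v \<in> \<Union>K}"
    by auto
  ultimately show "open (\<Union>K)" by (simp add: open_cp2_def)
qed

end

text \<open>The point \<open>[x : y : z]\<close>; meaningful only if \<open>x\<close>, \<open>y\<close>, \<open>z\<close> are not all zero.\<close>

definition proj_point :: "complex \<Rightarrow> complex \<Rightarrow> complex \<Rightarrow> cp2" where
  "proj_point x y z = abs_cp2 (vector [x, y, z])"

definition affine_point :: "complex \<times> complex \<Rightarrow> cp2" where
  "affine_point p = proj_point (fst p) (snd p) 1"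

definition level_set :: "(complex \<Rightarrow> complex \<Rightarrow> complex) \<Rightarrow> complex \<Rightarrow> (complex \<times> complex) set" where
  "level_set H h = {(x, y). H x y = h}"

text \<open>For an algebraic set the closure in the classical topology of the projective plane
  is its projective (Zariski) closure.\<close>

definition projective_closure :: "(complex \<Rightarrow> complex \<Rightarrow> complex) \<Rightarrow> complex \<Rightarrow> cp2 set" where
  "projective_closure H h = closure (affine_point ` level_set H h)"

definition points_at_infinity :: "(complex \<Rightarrow> complex \<Rightarrow> complex) \<Rightarrow> complex \<Rightarrow> cp2 set" where
  "points_at_infinity H h = projective_closure H h - affine_point ` level_set H h"

definition ramification_points ::
    "(complex \<Rightarrow> complex \<Rightarrow> complex) \<Rightarrow> complex \<Rightarrow> (complex \<times> complex) set" where
  "ramification_points H h = {(x, y) \<in> level_set H h. deriv (\<lambda>t. H x t) y = 0}"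

text \<open>The number of ramification points of the projection \<open>(x, y) \<mapsto> x\<close> on the level set of \<open>h'\<close>
  tending to \<open>P\<close> as \<open>h'\<close> tends to \<open>h\<close>: the number of those lying in \<open>U\<close> for every
  sufficiently small neighbourhood \<open>U\<close> of \<open>P\<close> and every \<open>h' \<noteq> h\<close> sufficiently close to \<open>h\<close>,
  where the required closeness depends on \<open>U\<close>. Only finitely many values of a polynomial \<open>H\<close> are
  not generic, so \<open>h'\<close> is automatically generic.\<close>

definition ramification_number ::
    "(complex \<Rightarrow> complex \<Rightarrow> complex) \<Rightarrow> complex \<Rightarrow> cp2 \<Rightarrow> nat" where
  "ramification_number H h P = (THE N. \<exists>V. open V \<and> P \<in> V \<and>
     (\<forall>U. open U \<and> P \<in> U \<and> U \<subseteq> V \<longrightarrow>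
       (\<forall>\<^sub>F h' in at h. finite {p \<in> ramification_points H h'. affine_point p \<in> U} \<and>
                       card {p \<in> ramification_points H h'. affine_point p \<in> U} = N)))"

definition binary_form :: "nat \<Rightarrow> (nat \<Rightarrow> complex) \<Rightarrow> complex \<Rightarrow> complex \<Rightarrow> complex" where
  "binary_form d a x y = (\<Sum>j = 0..d. a j * x ^ (d - j) * y ^ j)"

text \<open>\<open>P\<close> is \<open>[\<beta>\<^sub>i : \<alpha>\<^sub>i : 0]\<close> for a factor \<open>(\<alpha>\<^sub>i x - \<beta>\<^sub>i y)\<^sup>N\<close> in a factorization of the form
  \<open>F\<close> into powers of pairwise non-proportional linear forms.\<close>

definition has_multiplicity :: "(complex \<Rightarrow> complex \<Rightarrow> complex) \<Rightarrow> cp2 \<Rightarrow> nat \<Rightarrow> bool" where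
  "has_multiplicity F P N \<longleftrightarrow>
     (\<exists>(m :: nat) (\<alpha> :: nat \<Rightarrow> complex) (\<beta> :: nat \<Rightarrow> complex) (\<nu> :: nat \<Rightarrow> nat).
        (\<forall>i<m. (\<alpha> i, \<beta> i) \<noteq> (0, 0) \<and> \<nu> i \<ge> 1) \<and>
        (\<forall>i<m. \<forall>k<m. i \<noteq> k \<longrightarrow> \<alpha> i * \<beta> k \<noteq> \<alpha> k * \<beta> i) \<and>
        (\<forall>x y. F x y = (\<Prod>i<m. (\<alpha> i * x - \<beta> i * y) ^ \<nu> i)) \<and>
        (\<exists>i<m. P = proj_point (\<beta> i) (\<alpha> i) 0 \<and> N = \<nu> i))"

end

theory Submission
  imports Defs "HOL-Complex_Analysis.Cauchy_Integral_Formula"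
    "HOL-Computational_Algebra.Fundamental_Theorem_Algebra"
begin

text \<open>
Write \<open>F\<close> for the top form \<open>H\<^sub>n\<^sub>+\<^sub>1\<close>. A point at infinity is \<open>[x : y : 0]\<close> with
\<open>F(x, y) = 0\<close> (\<open>points_at_infinityE\<close>). In the chart \<open>x = 1/z\<close>, \<open>y = t/z\<close>, where the line at
infinity is \<open>z = 0\<close>, the ramification points on the level \<open>h\<close> are the solutions with \<open>z \<noteq> 0\<close>
of \<open>z ^ (n - 1) = - F\<^sub>y(1, t)\<close> and \<open>h z ^ (n + 1) = t z ^ (n - 1) + F(1, t)\<close>. Together they
say \<open>h z\<^sup>2 = t - F(1, t) / F\<^sub>y(1, t)\<close>.

At a root \<open>t\<^sub>0 \<noteq> 0\<close> of \<open>F(1, t)\<close> the quotient \<open>F / F\<^sub>y\<close> tends to \<open>0\<close>, so the right-hand side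
tends to \<open>t\<^sub>0\<close> while the left-hand side tends to \<open>0\<close> if \<open>z\<close> does. Hence no ramification
point approaches such a point (\<open>ramification_number_other_directions\<close>).

At \<open>t\<^sub>0 = 0\<close>, a root of order \<open>N\<close>, the right-hand side is \<open>(1 - 1/N) t\<close> up to higher order,
and the first equation reads \<open>z ^ (n - 1) \<approx> const t ^ (N - 1)\<close>. Eliminating \<open>t\<close> gives
\<open>z ^ (n + 1 - 2 N) = h ^ (N - 1) M(t)\<close> with \<open>M(0) \<noteq> 0\<close>. The least index of a nonzero
coefficient of \<open>F\<close> is \<open>N\<close>, so the assumption on \<open>a j\<close> gives \<open>2 N < n + 1\<close>, and the exponent
of \<open>z\<close> is positive. If \<open>N = 1\<close> or \<open>h \<noteq> 0\<close>, then \<open>z\<close> is bounded away from \<open>0\<close> and there are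
no ramification points nearby (\<open>local_system_no_solutions\<close>). If \<open>N \<ge> 2\<close> and \<open>h\<close> tends to
\<open>0\<close>, exactly \<open>n + 1 - 2 N\<close> ramification points approach the point (\<open>local_system_count\<close>): up
to a holomorphic factor \<open>R(t)\<close>, \<open>z\<close> is one of the \<open>n + 1 - 2 N\<close> roots of a constant, and for
each of them \<open>t\<close> is found by the contraction principle. An exact count is necessary, because
the ramification number is defined as the number of points that is eventually constant on
all small neighbourhoods.

The point \<open>[0 : 1 : 0]\<close> leads to a local system of the same form in the chart \<open>x = t/z\<close>,
\<open>y = 1/z\<close>, with the assumption on \<open>a k\<close> in place of that on \<open>a j\<close>. Finally, the multiplicity
of a point is the order of vanishing of \<open>F\<close> along a transversal line
(\<open>has_multiplicity_along_line\<close>), and a multiplicity exists by the fundamental theorem of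
algebra (\<open>has_multiplicity_exists\<close>).
\<close>

section \<open>Points and charts of the projective plane\<close>

lemma abs_cp2_eq_iff:
  assumes "u \<noteq> 0" "v \<noteq> 0"
  shows "abs_cp2 u = abs_cp2 v \<longleftrightarrow> (\<exists>c. c \<noteq> 0 \<and> v = c *s u)"
proof -
  have refl: "proportional w w" if "w \<noteq> 0" for w
    using that by (auto simp: proportional_def intro!: exI[of _ 1])
  show ?thesis
    using Quotient_rel[OF Quotient_cp2, of u v] refl[OF assms(1)] refl[OF assms(2)] assms
    by (auto simp: proportional_def)
qed

lemma cp2_cases:
  obtains v where "v \<noteq> 0" "P = abs_cp2 v"
proof
  show "rep_cp2 P \<noteq> 0"
    using Quotient_rep_reflp[OF Quotient_cp2, of P] by (auto simp: proportional_def)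
  show "P = abs_cp2 (rep_cp2 P)"
    by (rule Quotient_abs_rep[OF Quotient_cp2, symmetric])
qed

lemma vector3_eta: "v = vector [v $ 1, v $ 2, v $ 3]" for v :: "complex^3"
  by (simp add: vec_eq_iff forall_3 vector_3)

lemma vector3_eq_0_iff: "vector [x, y, z] = (0 :: complex^3) \<longleftrightarrow> x = 0 \<and> y = 0 \<and> z = 0"
  by (simp add: vec_eq_iff forall_3 vector_3)

lemma proj_point_eq_iff:
  assumes "(x, y, z) \<noteq> (0, 0, 0)" "(x', y', z') \<noteq> (0, 0, 0)"
  shows "proj_point x y z = proj_point x' y' z' \<longleftrightarrow>
    (\<exists>c. c \<noteq> 0 \<and> x' = c * x \<and> y' = c * y \<and> z' = c * z)"
proof -
  have "(vector [x', y', z'] = c *s (vector [x, y, z] :: complex^3)) \<longleftrightarrow>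
      x' = c * x \<and> y' = c * y \<and> z' = c * z" for c
    by (simp add: vec_eq_iff forall_3 vector_3)
  then show ?thesis
    using assms unfolding proj_point_def
    by (subst abs_cp2_eq_iff) (auto simp: vector3_eq_0_iff)
qed

lemma proj_point_cases:
  obtains x y z where "(x, y, z) \<noteq> (0, 0, 0)" "P = proj_point x y z"
proof -
  obtain v where v: "v \<noteq> 0" "P = abs_cp2 v" by (rule cp2_cases)
  show ?thesis
  proof (rule that[of "v $ 1" "v $ 2" "v $ 3"])
    show "(v $ 1, v $ 2, v $ 3) \<noteq> (0, 0, 0)"
      using v(1) by (simp add: vec_eq_iff forall_3)
    show "P = proj_point (v $ 1) (v $ 2) (v $ 3)"
      using v(2) by (simp only: proj_point_def flip: vector3_eta)
  qed
qed

text \<open>Openness in the quotient topology is openness of the cone over the set, and the cone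
  over the locus where a function with scaling-invariant zeros does not vanish is the locus
  upstairs.\<close>

lemma open_nonvanishing_locus:
  assumes "continuous_on UNIV (\<lambda>v :: complex^3. G (v $ 1) (v $ 2) (v $ 3) :: complex)"
    and "\<And>c x y z. c \<noteq> 0 \<Longrightarrow> G (c * x) (c * y) (c * z) = 0 \<longleftrightarrow> G x y z = 0"
  shows "open {proj_point x y z | x y z. (x, y, z) \<noteq> (0, 0, 0) \<and> G x y z \<noteq> 0}" (is "open ?W")
proof -
  have "abs_cp2 v \<in> ?W \<longleftrightarrow> G (v $ 1) (v $ 2) (v $ 3) \<noteq> 0" if v: "v \<noteq> 0" for v
  proof
    assume "abs_cp2 v \<in> ?W"
    then obtain x y z where xyz: "(x, y, z) \<noteq> (0, 0, 0)" "G x y z \<noteq> 0"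
      "abs_cp2 v = abs_cp2 (vector [x, y, z])"
      by (auto simp: proj_point_def)
    then obtain c where c: "c \<noteq> 0" "v = c *s vector [x, y, z]"
      using v abs_cp2_eq_iff[of "vector [x, y, z]" v] by (auto simp: vector3_eq_0_iff)
    then show "G (v $ 1) (v $ 2) (v $ 3) \<noteq> 0"
      using xyz(2) assms(2)[of c x y z] by (simp add: vector_3)
  next
    assume "G (v $ 1) (v $ 2) (v $ 3) \<noteq> 0"
    moreover have "(v $ 1, v $ 2, v $ 3) \<noteq> (0, 0, 0)"
      using v by (simp add: vec_eq_iff forall_3)
    moreover have "abs_cp2 v = proj_point (v $ 1) (v $ 2) (v $ 3)"
      by (simp only: proj_point_def flip: vector3_eta)
    ultimately show "abs_cp2 v \<in> ?W" by blast
  qed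
  moreover define W where "W = ?W"
  ultimately have "{v. v \<noteq> 0 \<and> abs_cp2 v \<in> W} = - {0} \<inter> {v. G (v $ 1) (v $ 2) (v $ 3) \<noteq> 0}"
    by auto
  moreover have "open {v :: complex^3. G (v $ 1) (v $ 2) (v $ 3) \<noteq> 0}"
    using assms(1) by (intro open_Collect_neq continuous_on_const)
  ultimately show ?thesis
    unfolding open_cp2_def W_def by (simp only: open_Compl closed_singleton open_Int)
qed

lemma open_vimage_vector3:
  assumes "open U" and "continuous_on UNIV f" and "\<And>w. f w \<noteq> (0 :: complex^3)"
  shows "open ((\<lambda>w. abs_cp2 (f w)) -` U)"
proof -
  have "open (f -` {v. v \<noteq> 0 \<and> abs_cp2 v \<in> U})"
    using assms by (intro open_vimage) (auto simp: open_cp2_def)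
  moreover have "f -` {v. v \<noteq> 0 \<and> abs_cp2 v \<in> U} = (\<lambda>w. abs_cp2 (f w)) -` U"
    using assms(3) by auto
  ultimately show ?thesis by simp
qed

definition chart_x :: "complex \<times> complex \<Rightarrow> cp2" where
  "chart_x w = proj_point 1 (fst w) (snd w)"

definition chart_y :: "complex \<times> complex \<Rightarrow> cp2" where
  "chart_y w = proj_point (fst w) 1 (snd w)"

lemma continuous_on_vector3:
  assumes "continuous_on S f" "continuous_on S g" "continuous_on S h"
  shows "continuous_on S (\<lambda>w. vector [f w, g w, h w] :: complex^3)"
proof -
  have "vector [f w, g w, h w] = (\<chi> i. if i = (1 :: 3) then f w else if i = 2 then g w else h w)" for w
    by (simp add: vec_eq_iff forall_3 vector_3)
  moreover have "continuous_on S (\<lambda>w. if i = (1 :: 3) then f w else if i = 2 then g w else h w)" for i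
    using assms by (cases "i = 1"; cases "i = 2") simp_all
  ultimately show ?thesis
    by (simp only: continuous_on_vec_lambda)
qed

lemma open_vimage_chart_x:
  assumes "open U"
  shows "open (chart_x -` U)"
proof -
  have "continuous_on UNIV (\<lambda>w :: complex \<times> complex. vector [1, fst w, snd w] :: complex^3)"
    by (rule continuous_on_vector3) (intro continuous_intros)+
  then have "open ((\<lambda>w :: complex \<times> complex. abs_cp2 (vector [1, fst w, snd w])) -` U)"
    by (rule open_vimage_vector3[OF assms]) (simp add: vector3_eq_0_iff)
  then show ?thesis
    by (simp add: chart_x_def[abs_def] proj_point_def)
qed

lemma open_vimage_chart_y:
  assumes "open U"
  shows "open (chart_y -` U)"
proof -
  have "continuous_on UNIV (\<lambda>w :: complex \<times> complex. vector [fst w, 1, snd w] :: complex^3)"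
    by (rule continuous_on_vector3) (intro continuous_intros)+
  then have "open ((\<lambda>w :: complex \<times> complex. abs_cp2 (vector [fst w, 1, snd w])) -` U)"
    by (rule open_vimage_vector3[OF assms]) (simp add: vector3_eq_0_iff)
  then show ?thesis
    by (simp add: chart_y_def[abs_def] proj_point_def)
qed

text \<open>The chart inverts to the ratios of the homogeneous coordinates, which are continuous
  where the denominator does not vanish; this makes the chart an open map.\<close>

lemma abs_cp2_in_chart_x_image:
  assumes "v \<noteq> 0"
  shows "abs_cp2 v \<in> chart_x ` W \<longleftrightarrow> v $ 1 \<noteq> 0 \<and> (v $ 2 / v $ 1, v $ 3 / v $ 1) \<in> W"
proof -
  have "abs_cp2 v = chart_x w \<longleftrightarrow> v $ 1 \<noteq> 0 \<and> w = (v $ 2 / v $ 1, v $ 3 / v $ 1)" for w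
  proof -
    have "abs_cp2 v = chart_x w \<longleftrightarrow> (\<exists>c. c \<noteq> 0 \<and> v = c *s vector [1, fst w, snd w])"
      using assms abs_cp2_eq_iff[of "vector [1, fst w, snd w]" v]
      by (auto simp: chart_x_def proj_point_def vector3_eq_0_iff)
    also have "\<dots> \<longleftrightarrow> v $ 1 \<noteq> 0 \<and> w = (v $ 2 / v $ 1, v $ 3 / v $ 1)"
      by (cases w) (auto simp: vec_eq_iff forall_3 vector_3)
    finally show ?thesis .
  qed
  then show ?thesis by (metis (no_types, lifting) image_iff)
qed

lemma abs_cp2_in_chart_y_image:
  assumes "v \<noteq> 0"
  shows "abs_cp2 v \<in> chart_y ` W \<longleftrightarrow> v $ 2 \<noteq> 0 \<and> (v $ 1 / v $ 2, v $ 3 / v $ 2) \<in> W"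
proof -
  have "abs_cp2 v = chart_y w \<longleftrightarrow> v $ 2 \<noteq> 0 \<and> w = (v $ 1 / v $ 2, v $ 3 / v $ 2)" for w
  proof -
    have "abs_cp2 v = chart_y w \<longleftrightarrow> (\<exists>c. c \<noteq> 0 \<and> v = c *s vector [fst w, 1, snd w])"
      using assms abs_cp2_eq_iff[of "vector [fst w, 1, snd w]" v]
      by (auto simp: chart_y_def proj_point_def vector3_eq_0_iff)
    also have "\<dots> \<longleftrightarrow> v $ 2 \<noteq> 0 \<and> w = (v $ 1 / v $ 2, v $ 3 / v $ 2)"
      by (cases w) (auto simp: vec_eq_iff forall_3 vector_3)
    finally show ?thesis .
  qed
  then show ?thesis by (metis (no_types, lifting) image_iff)
qed

lemma open_ratio_vimage:
  fixes i j k :: 3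
  assumes "open W"
  shows "open {v :: complex^3. v $ i \<noteq> 0 \<and> (v $ j / v $ i, v $ k / v $ i) \<in> W}"
proof -
  let ?D = "{v :: complex^3. v $ i \<noteq> 0}"
  have op: "open ?D" by (intro open_Collect_neq continuous_intros)
  have "continuous_on ?D (\<lambda>v. (v $ j / v $ i, v $ k / v $ i))"
    by (intro continuous_intros) auto
  then have "open (?D \<inter> (\<lambda>v. (v $ j / v $ i, v $ k / v $ i)) -` W)"
    using op assms by (rule continuous_open_preimage)
  then show ?thesis by (simp add: Int_def vimage_def)
qed

lemma open_chart_x_image: "open W \<Longrightarrow> open (chart_x ` W)"
proof -
  assume "open W"
  moreover have "{v. v \<noteq> 0 \<and> abs_cp2 v \<in> chart_x ` W} =
     {v. v $ 1 \<noteq> 0 \<and> (v $ 2 / v $ 1, v $ 3 / v $ 1) \<in> W}"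
    by (rule Collect_cong) (metis abs_cp2_in_chart_x_image zero_index)
  ultimately show ?thesis by (simp add: open_cp2_def open_ratio_vimage)
qed

lemma open_chart_y_image: "open W \<Longrightarrow> open (chart_y ` W)"
proof -
  assume "open W"
  moreover have "{v. v \<noteq> 0 \<and> abs_cp2 v \<in> chart_y ` W} =
     {v. v $ 2 \<noteq> 0 \<and> (v $ 1 / v $ 2, v $ 3 / v $ 2) \<in> W}"
    by (rule Collect_cong) (metis abs_cp2_in_chart_y_image zero_index)
  ultimately show ?thesis by (simp add: open_cp2_def open_ratio_vimage)
qed

lemma affine_point_eq_chart_x_iff:
  "affine_point p = chart_x (t, z) \<longleftrightarrow> z \<noteq> 0 \<and> p = (1 / z, t / z)"
  by (cases p) (auto simp: affine_point_def chart_x_def proj_point_eq_iff field_simps)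

lemma affine_point_eq_chart_y_iff:
  "affine_point p = chart_y (t, z) \<longleftrightarrow> z \<noteq> 0 \<and> p = (t / z, 1 / z)"
  by (cases p) (auto simp: affine_point_def chart_y_def proj_point_eq_iff field_simps)

lemma chart_x_embedding:
  "open W \<Longrightarrow> open (chart_x ` W)" "open U \<Longrightarrow> open (chart_x -` U)"
    "affine_point p = chart_x (t, z) \<longleftrightarrow> z \<noteq> 0 \<and> p = (\<lambda>w. (1 / snd w, fst w / snd w)) (t, z)"
    "inj_on (\<lambda>w. (1 / snd w, fst w / snd w)) {w :: complex \<times> complex. snd w \<noteq> 0}"
  by (auto simp: open_chart_x_image open_vimage_chart_x affine_point_eq_chart_x_iff inj_on_def)

lemma chart_y_embedding:
  "open W \<Longrightarrow> open (chart_y ` W)" "open U \<Longrightarrow> open (chart_y -` U)"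
    "affine_point p = chart_y (t, z) \<longleftrightarrow> z \<noteq> 0 \<and> p = (\<lambda>w. (fst w / snd w, 1 / snd w)) (t, z)"
    "inj_on (\<lambda>w. (fst w / snd w, 1 / snd w)) {w :: complex \<times> complex. snd w \<noteq> 0}"
  by (auto simp: open_chart_y_image open_vimage_chart_y affine_point_eq_chart_y_iff inj_on_def)

section \<open>Counting ramification points in a chart\<close>

text \<open>Two admissible counts agree: both are attained on the intersection of their
  neighbourhoods, for a common value of the level.\<close>

lemma ramification_number_eqI:
  assumes "open V" "P \<in> V"
    and "\<And>U. open U \<Longrightarrow> P \<in> U \<Longrightarrow> U \<subseteq> V \<Longrightarrow> \<forall>\<^sub>F h' in at h.
      finite {p \<in> ramification_points H h'. affine_point p \<in> U} \<and>
      card {p \<in> ramification_points H h'. affine_point p \<in> U} = N"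
  shows "ramification_number H h P = N"
  unfolding ramification_number_def
proof (rule the_equality)
  show "\<exists>V. open V \<and> P \<in> V \<and> (\<forall>U. open U \<and> P \<in> U \<and> U \<subseteq> V \<longrightarrow>
     (\<forall>\<^sub>F h' in at h. finite {p \<in> ramification_points H h'. affine_point p \<in> U} \<and>
                     card {p \<in> ramification_points H h'. affine_point p \<in> U} = N))"
    using assms by blast
next
  fix N'
  assume "\<exists>V. open V \<and> P \<in> V \<and> (\<forall>U. open U \<and> P \<in> U \<and> U \<subseteq> V \<longrightarrow>
     (\<forall>\<^sub>F h' in at h. finite {p \<in> ramification_points H h'. affine_point p \<in> U} \<and>
                     card {p \<in> ramification_points H h'. affine_point p \<in> U} = N'))"
  then obtain V' where V': "open V'" "P \<in> V'" and cnt: "\<And>U. open U \<Longrightarrow> P \<in> U \<Longrightarrow> U \<subseteq> V' \<Longrightarrow>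
     (\<forall>\<^sub>F h' in at h. finite {p \<in> ramification_points H h'. affine_point p \<in> U} \<and>
                     card {p \<in> ramification_points H h'. affine_point p \<in> U} = N')"
    by blast
  have "open (V \<inter> V')" "P \<in> V \<inter> V'" using assms V' by auto
  then have "\<forall>\<^sub>F h' in at h. N = N'"
    by (intro eventually_elim2[OF assms(3)[of "V \<inter> V'"] cnt[of "V \<inter> V'"]]) auto
  then show "N' = N" by (simp add: eventually_const_iff)
qed

text \<open>The count only involves small neighbourhoods of the point, so it can be carried out in
  the coordinates \<open>(t, z)\<close> of any open embedding \<open>\<kappa>\<close>. Here \<open>\<alpha>\<close> gives the affine coordinates
  of the chart point; the line at infinity is \<open>z = 0\<close>.\<close>

lemma ramification_number_eq_chartI:
  fixes \<kappa> :: "complex \<times> complex \<Rightarrow> cp2"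
  assumes op: "\<And>W. open W \<Longrightarrow> open (\<kappa> ` W)" and cont: "\<And>U. open U \<Longrightarrow> open (\<kappa> -` U)"
    and aff: "\<And>p t z. affine_point p = \<kappa> (t, z) \<longleftrightarrow> z \<noteq> 0 \<and> p = \<alpha> (t, z)"
    and inj: "inj_on \<alpha> {w. snd w \<noteq> 0}"
    and W: "open W" "w0 \<in> W"
    and cnt: "\<And>W'. open W' \<Longrightarrow> w0 \<in> W' \<Longrightarrow> W' \<subseteq> W \<Longrightarrow> \<forall>\<^sub>F h' in at h.
      finite {w \<in> W'. snd w \<noteq> 0 \<and> \<alpha> w \<in> ramification_points H h'} \<and>
      card {w \<in> W'. snd w \<noteq> 0 \<and> \<alpha> w \<in> ramification_points H h'} = N"
  shows "ramification_number H h (\<kappa> w0) = N"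
proof (rule ramification_number_eqI)
  show "open (\<kappa> ` W)" "\<kappa> w0 \<in> \<kappa> ` W" using op W by auto
next
  fix U assume U: "open U" "\<kappa> w0 \<in> U" "U \<subseteq> \<kappa> ` W"
  let ?W = "\<kappa> -` U \<inter> W"
  have pts: "{p \<in> ramification_points H h'. affine_point p \<in> U} =
      \<alpha> ` {w \<in> ?W. snd w \<noteq> 0 \<and> \<alpha> w \<in> ramification_points H h'}" for h'
  proof (intro set_eqI iffI)
    fix p assume p: "p \<in> {p \<in> ramification_points H h'. affine_point p \<in> U}"
    then obtain w where w: "w \<in> W" "affine_point p = \<kappa> w" using U(3) by auto
    then have "snd w \<noteq> 0" "p = \<alpha> w" using aff[of p "fst w" "snd w"] by auto
    then show "p \<in> \<alpha> ` {w \<in> ?W. snd w \<noteq> 0 \<and> \<alpha> w \<in> ramification_points H h'}"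
      using p w by (intro image_eqI[of _ _ w]) auto
  next
    fix p assume "p \<in> \<alpha> ` {w \<in> ?W. snd w \<noteq> 0 \<and> \<alpha> w \<in> ramification_points H h'}"
    then obtain w where w: "w \<in> ?W" "snd w \<noteq> 0" "\<alpha> w \<in> ramification_points H h'" "p = \<alpha> w" by auto
    then have "affine_point p = \<kappa> w" using aff[of p "fst w" "snd w"] by auto
    then show "p \<in> {p \<in> ramification_points H h'. affine_point p \<in> U}"
      using w by auto
  qed
  have "inj_on \<alpha> {w \<in> ?W. snd w \<noteq> 0 \<and> \<alpha> w \<in> ramification_points H h'}" for h'
    by (rule inj_on_subset[OF inj]) auto
  then have "card {p \<in> ramification_points H h'. affine_point p \<in> U} =
      card {w \<in> ?W. snd w \<noteq> 0 \<and> \<alpha> w \<in> ramification_points H h'}" for h'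
    unfolding pts by (rule card_image)
  moreover have "\<forall>\<^sub>F h' in at h.
      finite {w \<in> ?W. snd w \<noteq> 0 \<and> \<alpha> w \<in> ramification_points H h'} \<and>
      card {w \<in> ?W. snd w \<noteq> 0 \<and> \<alpha> w \<in> ramification_points H h'} = N"
    using cont[OF U(1)] W U(2) by (intro cnt) auto
  ultimately show "\<forall>\<^sub>F h' in at h. finite {p \<in> ramification_points H h'. affine_point p \<in> U} \<and>
      card {p \<in> ramification_points H h'. affine_point p \<in> U} = N"
    unfolding pts by (auto elim!: eventually_mono)
qed

section \<open>Binary forms and the points at infinity\<close>

text \<open>The partial derivative of a binary form with respect to its second variable.\<close>

definition binary_form_dy :: "nat \<Rightarrow> (nat \<Rightarrow> complex) \<Rightarrow> complex \<Rightarrow> complex \<Rightarrow> complex" where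
  "binary_form_dy d a x y = (\<Sum>j = 0..d. of_nat j * a j * x ^ (d - j) * y ^ (j - 1))"

lemma binary_form_scale: "binary_form d a (c * x) (c * y) = c ^ d * binary_form d a x y"
  unfolding binary_form_def sum_distrib_left
proof (rule sum.cong[OF refl])
  fix i assume "i \<in> {0..d}"
  then have "c ^ d = c ^ (d - i) * c ^ i"
    by (simp flip: power_add)
  then show "a i * (c * x) ^ (d - i) * (c * y) ^ i = c ^ d * (a i * x ^ (d - i) * y ^ i)"
    by (simp add: power_mult_distrib)
qed

lemma binary_form_dy_scale:
  "binary_form_dy (Suc m) a (c * x) (c * y) = c ^ m * binary_form_dy (Suc m) a x y"
  unfolding binary_form_dy_def sum_distrib_left
proof (rule sum.cong[OF refl])
  fix i assume i: "i \<in> {0..Suc m}"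
  show "of_nat i * a i * (c * x) ^ (Suc m - i) * (c * y) ^ (i - 1) =
      c ^ m * (of_nat i * a i * x ^ (Suc m - i) * y ^ (i - 1))"
  proof (cases i)
    case (Suc k)
    then have "c ^ m = c ^ (Suc m - i) * c ^ (i - 1)"
      using i by (simp flip: power_add)
    then show ?thesis
      by (simp only: power_mult_distrib mult_ac)
  qed simp
qed

text \<open>The homogenized equation \<open>G\<close> vanishes on the affine curve, and its nonvanishing locus
  is open, so \<open>G\<close> vanishes on the closure. A point of the closure with \<open>z \<noteq> 0\<close> is therefore
  an affine point of the curve, and on \<open>z = 0\<close> only the top form survives.\<close>

lemma points_at_infinityE:
  assumes n: "n \<ge> 2"
    and P: "P \<in> points_at_infinity (\<lambda>x y. x * y + binary_form (n + 1) a x y) h"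
  obtains x y where "(x, y) \<noteq> (0, 0)" "P = proj_point x y 0" "binary_form (n + 1) a x y = 0"
proof -
  let ?H = "\<lambda>x y. x * y + binary_form (n + 1) a x y"
  let ?G = "\<lambda>x y z. x * y * z ^ (n - 1) + binary_form (n + 1) a x y - h * z ^ (n + 1)"
  have hom: "?G (c * x) (c * y) (c * z) = c ^ (n + 1) * ?G x y z" for c x y z
  proof -
    have "binary_form (n + 1) a (c * x) (c * y) = c ^ (n + 1) * binary_form (n + 1) a x y"
      by (rule binary_form_scale)
    moreover have "c * c * c ^ (n - 1) = c ^ (n + 1)"
      using n by (cases n) simp_all
    then have "c * x * (c * y) * (c * z) ^ (n - 1) = c ^ (n + 1) * (x * y * z ^ (n - 1))"
      by (simp only: power_mult_distrib) (metis (no_types, lifting) mult.assoc mult.left_commute)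
    moreover have "h * (c * z) ^ (n + 1) = c ^ (n + 1) * (h * z ^ (n + 1))"
      by (simp only: power_mult_distrib mult.left_commute)
    ultimately show ?thesis
      by (simp only: right_diff_distrib distrib_left)
  qed
  let ?W = "{proj_point x y z | x y z. (x, y, z) \<noteq> (0, 0, 0) \<and> ?G x y z \<noteq> 0}"
  have "open ?W"
  proof (rule open_nonvanishing_locus[of ?G])
    show "continuous_on UNIV (\<lambda>v :: complex^3. ?G (v $ 1) (v $ 2) (v $ 3))"
      unfolding binary_form_def by (intro continuous_intros)
  qed (simp only: hom, simp)
  moreover have "?W \<inter> affine_point ` level_set ?H h = {}"
  proof -
    have "proj_point x y z \<noteq> affine_point p"
      if p: "p \<in> level_set ?H h" and xyz: "(x, y, z) \<noteq> (0, 0, 0)" "?G x y z \<noteq> 0" for p x y z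
    proof
      assume "proj_point x y z = affine_point p"
      then obtain c where "c \<noteq> 0" "x = c * fst p" "y = c * snd p" "z = c * 1"
        using xyz proj_point_eq_iff[of "fst p" "snd p" 1 x y z] by (auto simp: affine_point_def)
      moreover have "?G (fst p) (snd p) 1 = 0" using p by (auto simp: level_set_def)
      ultimately have "?G x y z = 0" using hom by (simp only: mult_zero_right)
      then show False using xyz by blast
    qed
    then show ?thesis by blast
  qed
  ultimately have "?W \<inter> projective_closure ?H h = {}"
    unfolding projective_closure_def by (simp only: open_Int_closure_eq_empty)
  then have PW: "P \<notin> ?W" using P by (auto simp: points_at_infinity_def)
  obtain x y z where xyz: "(x, y, z) \<noteq> (0, 0, 0)" "P = proj_point x y z"
    by (rule proj_point_cases)
  then have G0: "?G x y z = 0" using PW by blast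
  have "z = 0"
  proof (rule ccontr)
    assume z: "z \<noteq> 0"
    have "?G (inverse z * x) (inverse z * y) (inverse z * z) = 0"
      unfolding hom G0 by simp
    then have "(x / z, y / z) \<in> level_set ?H h"
      using z by (simp add: level_set_def field_simps)
    moreover have "P = affine_point (x / z, y / z)"
    proof -
      have "\<exists>c. c \<noteq> 0 \<and> x / z = c * x \<and> y / z = c * y \<and> 1 = c * z"
        using z by (intro exI[of _ "inverse z"]) (simp add: field_simps)
      then show ?thesis
        using z unfolding xyz(2) affine_point_def by (simp add: proj_point_eq_iff)
    qed
    ultimately show False using P by (auto simp: points_at_infinity_def)
  qed
  moreover obtain m where "n = Suc (Suc m)" using n by (metis add_2_eq_Suc le_Suc_ex)
  ultimately have "binary_form (n + 1) a x y = 0" using G0 by simp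
  then show ?thesis using that[of x y] xyz \<open>z = 0\<close> by simp
qed

section \<open>The ramification equations in the charts\<close>

lemma binary_form_has_derivative:
  "((\<lambda>t. x * t + binary_form d a x t) has_field_derivative x + binary_form_dy d a x y) (at y)"
  unfolding binary_form_def binary_form_dy_def
  by (auto intro!: derivative_eq_intros sum.cong simp: mult_ac)

lemma ramification_points_iff:
  "(x, y) \<in> ramification_points (\<lambda>x y. x * y + binary_form d a x y) h \<longleftrightarrow>
    x * y + binary_form d a x y = h \<and> x + binary_form_dy d a x y = 0"
  by (auto simp: ramification_points_def level_set_def
      DERIV_imp_deriv[OF binary_form_has_derivative])

text \<open>Both ramification equations become polynomial in \<open>z\<close> after multiplication by a power
  of \<open>z\<close>; \<open>s\<close>, \<open>u\<close>, \<open>F\<close> and \<open>G\<close> stand for the values at the chart coordinate \<open>t\<close>.\<close>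

lemma scaled_system_iff:
  fixes z :: complex
  assumes "z \<noteq> 0" "n \<ge> 1"
  shows "(1 / z) * (1 / z) * s + (1 / z) ^ (n + 1) * F = h \<longleftrightarrow> h * z ^ (n + 1) = s * z ^ (n - 1) + F"
    and "(1 / z) * u + (1 / z) ^ n * G = 0 \<longleftrightarrow> u * z ^ (n - 1) + G = 0"
proof -
  obtain m where n: "n = Suc m" using assms(2) by (cases n) auto
  show "(1 / z) * (1 / z) * s + (1 / z) ^ (n + 1) * F = h \<longleftrightarrow> h * z ^ (n + 1) = s * z ^ (n - 1) + F"
    using assms(1) by (simp add: n power_divide field_simps) (auto simp: algebra_simps)
  show "(1 / z) * u + (1 / z) ^ n * G = 0 \<longleftrightarrow> u * z ^ (n - 1) + G = 0"
    using assms(1) by (simp add: n power_divide field_simps)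
qed

lemma ramification_points_chart_x:
  assumes "z \<noteq> 0" "n \<ge> 1"
  shows "(1 / z, t / z) \<in> ramification_points (\<lambda>x y. x * y + binary_form (n + 1) a x y) h \<longleftrightarrow>
    h * z ^ (n + 1) = t * z ^ (n - 1) + binary_form (n + 1) a 1 t \<and>
    z ^ (n - 1) + binary_form_dy (n + 1) a 1 t = 0"
  using scaled_system_iff(1)[OF assms, of t "binary_form (n + 1) a 1 t" h]
    scaled_system_iff(2)[OF assms, of 1 "binary_form_dy (n + 1) a 1 t"]
    binary_form_scale[of "n + 1" a "1 / z" 1 t] binary_form_dy_scale[of n a "1 / z" 1 t]
  by (simp add: ramification_points_iff)

lemma ramification_points_chart_y:
  assumes "z \<noteq> 0" "n \<ge> 1"
  shows "(t / z, 1 / z) \<in> ramification_points (\<lambda>x y. x * y + binary_form (n + 1) a x y) h \<longleftrightarrow>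
    h * z ^ (n + 1) = t * z ^ (n - 1) + binary_form (n + 1) a t 1 \<and>
    t * z ^ (n - 1) + binary_form_dy (n + 1) a t 1 = 0"
  using scaled_system_iff(1)[OF assms, of t "binary_form (n + 1) a t 1" h]
    scaled_system_iff(2)[OF assms, of t "binary_form_dy (n + 1) a t 1"]
    binary_form_scale[of "n + 1" a "1 / z" t 1] binary_form_dy_scale[of n a "1 / z" t 1]
  by (simp add: ramification_points_iff)

lemma sum_drop_zeros:
  fixes c :: "nat \<Rightarrow> 'a :: comm_monoid_add"
  assumes "\<And>i. i < N \<Longrightarrow> c i = 0" "N \<le> d"
  shows "(\<Sum>j = 0..d. c j) = (\<Sum>i = 0..d - N. c (i + N))"
proof -
  have "(\<Sum>j = 0..d. c j) = (\<Sum>j = N..d. c j)"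
    using assms(1) by (intro sum.mono_neutral_right) auto
  also have "\<dots> = (\<Sum>i = 0..d - N. c (i + N))"
    using assms(2) sum.shift_bounds_cl_nat_ivl[of c 0 N "d - N"] by simp
  finally show ?thesis .
qed

lemma binary_form_x_expansion:
  assumes "\<And>i. i < N \<Longrightarrow> a i = 0" "N \<le> d" "1 \<le> N"
  shows "binary_form d a 1 t = t ^ N * (\<Sum>i = 0..d - N. a (i + N) * t ^ i)"
    and "binary_form_dy d a 1 t = t ^ (N - 1) * (\<Sum>i = 0..d - N. of_nat (i + N) * a (i + N) * t ^ i)"
proof -
  show "binary_form d a 1 t = t ^ N * (\<Sum>i = 0..d - N. a (i + N) * t ^ i)"
    unfolding binary_form_def using assms
    by (subst sum_drop_zeros[where N = N]) (auto simp: sum_distrib_left power_add mult_ac intro!: sum.cong)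
  show "binary_form_dy d a 1 t = t ^ (N - 1) * (\<Sum>i = 0..d - N. of_nat (i + N) * a (i + N) * t ^ i)"
  proof -
    have "t ^ (i + N - 1) = t ^ (N - 1) * t ^ i" for i
      using assms(3) by (simp add: add.commute flip: power_add)
    then show ?thesis
      unfolding binary_form_dy_def using assms
      by (subst sum_drop_zeros[where N = N]) (auto simp: sum_distrib_left mult_ac intro!: sum.cong)
  qed
qed

lemma binary_form_y_expansion:
  assumes "\<And>i. i < N \<Longrightarrow> a (d - i) = 0" "N \<le> d"
  shows "binary_form d a t 1 = t ^ N * (\<Sum>i = 0..d - N. a (d - (i + N)) * t ^ i)"
    and "binary_form_dy d a t 1 =
      t ^ N * (\<Sum>i = 0..d - N. of_nat (d - (i + N)) * a (d - (i + N)) * t ^ i)"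
proof -
  have "(\<Sum>j = 0..d. c j * t ^ (d - j)) = t ^ N * (\<Sum>i = 0..d - N. c (d - (i + N)) * t ^ i)"
    if "\<And>i. i < N \<Longrightarrow> c (d - i) = 0" for c
  proof -
    have "(\<Sum>j = 0..d. c j * t ^ (d - j)) = (\<Sum>j = 0..d. c (d - j) * t ^ j)"
      by (subst sum.atLeastAtMost_rev) (auto intro!: sum.cong)
    also have "\<dots> = t ^ N * (\<Sum>i = 0..d - N. c (d - (i + N)) * t ^ i)"
      using that assms(2)
      by (subst sum_drop_zeros[where N = N]) (auto simp: sum_distrib_left power_add mult_ac intro!: sum.cong)
    finally show ?thesis .
  qed
  from this[of a] this[of "\<lambda>j. of_nat j * a j"] assms(1)
  show "binary_form d a t 1 = t ^ N * (\<Sum>i = 0..d - N. a (d - (i + N)) * t ^ i)"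
    "binary_form_dy d a t 1 =
      t ^ N * (\<Sum>i = 0..d - N. of_nat (d - (i + N)) * a (d - (i + N)) * t ^ i)"
    by (simp_all add: binary_form_def binary_form_dy_def)
qed

section \<open>The local system at a coordinate point\<close>

text \<open>The equations of the ramification points in the chart \<open>(t, z)\<close> around a coordinate point at
  infinity of multiplicity \<open>N\<close>, after \<open>z ^ (n - 1)\<close> has been eliminated from the level equation and the
  common power of \<open>t\<close> cancelled: \<open>A\<close> and \<open>B\<close> are the top form and its derivative along the chart,
  divided by their powers of \<open>t\<close>.\<close>

definition local_system ::
    "nat \<Rightarrow> nat \<Rightarrow> (complex \<Rightarrow> complex) \<Rightarrow> (complex \<Rightarrow> complex) \<Rightarrow> complex \<Rightarrow> (complex \<times> complex) set" where
  "local_system n N A B h = {(t, z). z \<noteq> 0 \<and> z ^ (n - 1) = - (t ^ (N - 1) * B t) \<and>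
     h * z\<^sup>2 * B t = t * (B t - A t)}"

lemma power_split_exponent:
  fixes z :: complex
  assumes "1 \<le> N" "2 * N < n + 1"
  shows "z ^ (n - 1) = z ^ (n + 1 - 2 * N) * (z\<^sup>2) ^ (N - 1)"
proof -
  have "n - 1 = (n + 1 - 2 * N) + 2 * (N - 1)" using assms by simp
  then show ?thesis by (metis power_add power_mult)
qed

text \<open>Raising the second equation to the power \<open>N - 1\<close> and using it to eliminate the power
  of \<open>t\<close> from the first leaves a relation in which \<open>z\<close> occurs with the exponent
  \<open>n - 1 - 2 (N - 1)\<close>. The sign of this exponent decides whether \<open>z\<close> tends to zero or to
  infinity with \<open>h\<close>, which is why the bound \<open>2 N < n + 1\<close> matters.\<close>

lemma local_system_eliminant:
  assumes "(t, z) \<in> local_system n N A B h" and N: "1 \<le> N" "2 * N < n + 1"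
  shows "z ^ (n + 1 - 2 * N) * (B t - A t) ^ (N - 1) + h ^ (N - 1) * B t ^ N = 0"
proof -
  have z: "z \<noteq> 0" and e1: "z ^ (n - 1) = - (t ^ (N - 1) * B t)"
    and e2: "h * z\<^sup>2 * B t = t * (B t - A t)"
    using assms(1) by (auto simp: local_system_def)
  have "z ^ (n - 1) * (B t - A t) ^ (N - 1) = - (B t * (t * (B t - A t)) ^ (N - 1))"
    by (simp only: e1 power_mult_distrib) (simp add: algebra_simps)
  also have "\<dots> = - ((z\<^sup>2) ^ (N - 1) * (h ^ (N - 1) * B t ^ N))"
    unfolding e2[symmetric] using N(1) by (cases N) (simp_all add: power_mult_distrib)
  finally have "(z\<^sup>2) ^ (N - 1) *
      (z ^ (n + 1 - 2 * N) * (B t - A t) ^ (N - 1) + h ^ (N - 1) * B t ^ N) = 0"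
    unfolding power_split_exponent[OF N] by (simp add: algebra_simps)
  then show ?thesis using z by simp
qed

text \<open>Used with a quantity that is zero at every ramification point, this excludes
  ramification points near \<open>w\<close> on all nearby level curves.\<close>

lemma nonvanishing_nearby:
  fixes \<Phi> :: "'a :: t2_space \<times> 'b :: t2_space \<Rightarrow> 'c :: t1_space"
  assumes "isCont \<Phi> (h, w)" "\<Phi> (h, w) \<noteq> v"
  obtains W where "open W" "w \<in> W" "\<forall>\<^sub>F h' in at h. \<forall>w'\<in>W. \<Phi> (h', w') \<noteq> v"
proof -
  have "\<forall>\<^sub>F p in nhds (h, w). \<Phi> p \<noteq> v"
    using assms tendsto_imp_eventually_ne[of \<Phi> "\<Phi> (h, w)" "at (h, w)" v]
    by (simp add: isCont_def eventually_nhds_conv_at)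
  then obtain S where S: "open S" "(h, w) \<in> S" "\<forall>p\<in>S. \<Phi> p \<noteq> v"
    by (auto simp: eventually_nhds)
  then obtain U W where UW: "open U" "open W" "(h, w) \<in> U \<times> W" "U \<times> W \<subseteq> S"
    by (metis open_prod_elim)
  have "\<forall>\<^sub>F h' in at h. h' \<in> U"
    using UW by (intro eventually_at_in_open') auto
  then show ?thesis
    using UW S by (intro that[of W]) (auto elim!: eventually_mono)
qed

text \<open>At \<open>t = z = 0\<close> the eliminant takes the value \<open>h ^ (N - 1) * B 0 ^ N\<close>, which is nonzero
  under these hypotheses.\<close>

lemma local_system_no_solutions:
  assumes cont: "isCont A 0" "isCont B 0" and B0: "B 0 \<noteq> 0"
    and N: "1 \<le> N" "2 * N < n + 1" and h: "N = 1 \<or> h \<noteq> 0"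
  obtains W where "open W" "(0, 0) \<in> W" "\<forall>\<^sub>F h' in at h. local_system n N A B h' \<inter> W = {}"
proof -
  let ?\<Phi> = "\<lambda>p :: complex \<times> complex \<times> complex. snd (snd p) ^ (n + 1 - 2 * N) *
    (B (fst (snd p)) - A (fst (snd p))) ^ (N - 1) + fst p ^ (N - 1) * B (fst (snd p)) ^ N"
  have "isCont ?\<Phi> (h, 0, 0)"
  proof -
    have fs: "isCont (\<lambda>p :: complex \<times> complex \<times> complex. fst (snd p)) (h, 0, 0)"
      by (intro continuous_intros)
    have "isCont (\<lambda>p :: complex \<times> complex \<times> complex. A (fst (snd p))) (h, 0, 0)"
      by (rule isCont_o2[OF fs]) (simp add: cont)
    moreover have "isCont (\<lambda>p :: complex \<times> complex \<times> complex. B (fst (snd p))) (h, 0, 0)"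
      by (rule isCont_o2[OF fs]) (simp add: cont)
    ultimately show ?thesis by (intro continuous_intros)
  qed
  moreover have "?\<Phi> (h, 0, 0) \<noteq> 0"
    using B0 N h by (auto simp: power_0_left)
  ultimately obtain W where W: "open W" "(0, 0) \<in> W" "\<forall>\<^sub>F h' in at h. \<forall>w\<in>W. ?\<Phi> (h', w) \<noteq> 0"
    by (rule nonvanishing_nearby)
  show ?thesis
  proof (rule that[OF W(1,2)])
    show "\<forall>\<^sub>F h' in at h. local_system n N A B h' \<inter> W = {}"
      using W(3)
    proof eventually_elim
      case (elim h')
      have "?\<Phi> (h', w) = 0" if "w \<in> local_system n N A B h'" for w
        using local_system_eliminant[OF _ N, of "fst w" "snd w" A B h'] that by simp
      with elim show ?case by blast
    qed
  qed
qed

lemma holomorphic_imp_Lipschitz_near: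
  assumes f: "f holomorphic_on ball z0 r0" and r: "0 < r" "r < r0"
  obtains C where "C > 0" "\<And>x. x \<in> cball z0 r \<Longrightarrow> norm (f x) \<le> C"
    "\<And>x y. x \<in> cball z0 r \<Longrightarrow> y \<in> cball z0 r \<Longrightarrow> norm (f x - f y) \<le> C * norm (x - y)"
proof -
  have sub: "cball z0 r \<subseteq> ball z0 r0" using r by auto
  have "deriv f holomorphic_on ball z0 r0" using f by (intro holomorphic_deriv) auto
  then have "continuous_on (cball z0 r) (deriv f)" "continuous_on (cball z0 r) f"
    using f sub by (meson continuous_on_subset holomorphic_on_imp_continuous_on)+
  then have "bounded (deriv f ` cball z0 r)" "bounded (f ` cball z0 r)"
    by (simp_all add: compact_continuous_image compact_imp_bounded)
  then obtain C1 C2 where C: "\<forall>x\<in>cball z0 r. norm (deriv f x) \<le> C1" "\<forall>x\<in>cball z0 r. norm (f x) \<le> C2"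
    by (auto simp: bounded_iff)
  define C where "C = max 1 (max C1 C2)"
  show ?thesis
  proof
    show "C > 0" by (simp add: C_def)
    show "norm (f x) \<le> C" if "x \<in> cball z0 r" for x using C(2) that by (auto simp: C_def le_max_iff_disj)
    fix x y assume xy: "x \<in> cball z0 r" "y \<in> cball z0 r"
    show "norm (f x - f y) \<le> C * norm (x - y)"
    proof (rule field_differentiable_bound[of "cball z0 r" f "deriv f"])
      show "(f has_field_derivative deriv f z) (at z within cball z0 r)" if "z \<in> cball z0 r" for z
        using holomorphic_derivI[OF f open_ball] that sub by (meson DERIV_subset subsetD top_greatest)
      show "norm (deriv f z) \<le> C" if "z \<in> cball z0 r" for z
        using C(1) that by (auto simp: C_def le_max_iff_disj)
    qed (use xy in auto)
  qed
qed

text \<open>For small \<open>\<epsilon>\<close> the map \<open>t \<mapsto> \<epsilon> L(t)\<close> contracts the closed disc into the open one.\<close>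

lemma unique_small_fixed_point:
  fixes L :: "complex \<Rightarrow> complex"
  assumes "r > 0" "\<And>x. x \<in> cball 0 r \<Longrightarrow> norm (L x) \<le> C"
    and "\<And>x y. x \<in> cball 0 r \<Longrightarrow> y \<in> cball 0 r \<Longrightarrow> norm (L x - L y) \<le> C * norm (x - y)"
    and "norm \<epsilon> * C < r" "norm \<epsilon> * C < 1" "C > 0"
  shows "\<exists>!t. t \<in> ball 0 r \<and> t = \<epsilon> * L t"
proof -
  have bd: "norm (\<epsilon> * L x) < r" if "x \<in> cball 0 r" for x
    using mult_left_mono[OF assms(2)[OF that], of "norm \<epsilon>"] assms(4) by (simp add: norm_mult)
  have "\<exists>!t. t \<in> cball 0 r \<and> \<epsilon> * L t = t"
  proof (rule Banach_fix[where c = "norm \<epsilon> * C"])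
    show "(\<lambda>t. \<epsilon> * L t) ` cball 0 r \<subseteq> cball 0 r" using bd by (force intro: less_imp_le)
    fix x y :: complex assume "x \<in> cball 0 r" "y \<in> cball 0 r"
    then show "dist (\<epsilon> * L x) (\<epsilon> * L y) \<le> norm \<epsilon> * C * dist x y"
      using mult_left_mono[OF assms(3), of x y "norm \<epsilon>"]
      by (simp add: dist_norm norm_mult mult.assoc flip: right_diff_distrib)
  qed (use assms in \<open>auto simp: complete_eq_closed\<close>)
  moreover have "t \<in> cball 0 r \<and> \<epsilon> * L t = t \<longleftrightarrow> t \<in> ball 0 r \<and> t = \<epsilon> * L t" for t
    using bd[of t] by auto
  ultimately show ?thesis by simp
qed

text \<open>Near the origin the quotient \<open>M t / M 0\<close> stays in the right half plane, where the
  principal logarithm is holomorphic.\<close>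

lemma holomorphic_power_root_near:
  fixes M :: "complex \<Rightarrow> complex"
  assumes M: "M holomorphic_on ball 0 r0" "r0 > 0" "M 0 \<noteq> 0" "q > 0"
  obtains r R where "0 < r" "r \<le> r0" "R holomorphic_on ball 0 r"
    "\<And>t. t \<in> ball 0 r \<Longrightarrow> R t ^ q = M t / M 0" "\<And>t. R t \<noteq> 0"
proof -
  define m where "m t = M t / M 0" for t
  have "isCont M 0"
    using M holomorphic_on_imp_continuous_on[of M "ball 0 r0"]
    by (simp add: continuous_on_interior)
  then have "isCont (\<lambda>t. M t / M 0) 0" using M(3) by (intro continuous_divide) auto
  then have "isCont (\<lambda>t. Re (m t)) 0" unfolding m_def by (rule isCont_Re)
  then have "\<forall>\<^sub>F t in at 0. Re (m t) > 0"
    using M(3) by (intro order_tendstoD(1)[of _ "Re (m 0)"]) (auto simp: isCont_def m_def)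
  then obtain d where d: "d > 0" "\<And>t. t \<noteq> 0 \<Longrightarrow> norm t < d \<Longrightarrow> Re (m t) > 0"
    by (auto simp: eventually_at dist_norm)
  define r where "r = min d r0"
  have pos: "Re (m t) > 0" if "t \<in> ball 0 r" for t
    using d(2)[of t] that M(3) by (cases "t = 0") (auto simp: r_def m_def)
  define R where "R t = exp (Ln (m t) / of_nat q)" for t
  show ?thesis
  proof
    show "0 < r" "r \<le> r0" using d M by (auto simp: r_def)
    have m: "m holomorphic_on ball 0 r"
      unfolding m_def using M by (intro holomorphic_intros holomorphic_on_subset[OF M(1)]) (auto simp: r_def)
    then show "R holomorphic_on ball 0 r"
      unfolding R_def using pos M(4)
      by (intro holomorphic_intros m) (auto simp: complex_nonpos_Reals_iff not_le dest: less_imp_le)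
    show "R t ^ q = M t / M 0" if "t \<in> ball 0 r" for t
    proof -
      have "m t \<noteq> 0" using pos[OF that] by auto
      then show ?thesis using M(4) by (simp add: R_def m_def flip: exp_of_nat_mult)
    qed
    show "R t \<noteq> 0" for t by (simp add: R_def)
  qed
qed

text \<open>This decouples the system. With \<open>k = B / (B - A)\<close>, the solutions satisfy
  \<open>t = h z\<^sup>2 k(t)\<close> and \<open>z ^ q = - h ^ (N - 1) B(t) k(t) ^ (N - 1)\<close> where \<open>q = n + 1 - 2 N\<close>.
  If \<open>R\<close> is a branch of the normalized \<open>q\<close>-th root of the last factor, then \<open>c = z / R(t)\<close>
  is one of finitely many constants, and \<open>t\<close> solves a fixed point equation in one variable
  with parameter \<open>h c\<^sup>2\<close>.\<close>

lemma local_system_iff_root: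
  assumes B: "B t \<noteq> 0" "B t \<noteq> A t" and R: "R t \<noteq> 0"
    and M0: "R t ^ (n + 1 - 2 * N) * M0 = B t * (B t / (B t - A t)) ^ (N - 1)"
    and h: "h \<noteq> 0" and N: "1 \<le> N" "2 * N < n + 1"
  shows "(t, z) \<in> local_system n N A B h \<longleftrightarrow>
    (\<exists>c. c ^ (n + 1 - 2 * N) = - (h ^ (N - 1) * M0) \<and> z = c * R t \<and>
         t = h * c\<^sup>2 * ((R t)\<^sup>2 * (B t / (B t - A t))))"
proof
  let ?q = "n + 1 - 2 * N" and ?k = "B t / (B t - A t)"
  have k: "?k * (B t - A t) = B t" using B by simp
  {
    assume S: "(t, z) \<in> local_system n N A B h"
    have e2: "h * z\<^sup>2 * B t = t * (B t - A t)" using S by (auto simp: local_system_def)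
    have "z ^ ?q * (B t - A t) ^ (N - 1) = - (h ^ (N - 1) * B t ^ N)"
      using local_system_eliminant[OF S N] by (simp add: eq_neg_iff_add_eq_0)
    also have "B t ^ N = B t * (?k * (B t - A t)) ^ (N - 1)"
      unfolding k using N(1) by (cases N) simp_all
    also have "\<dots> = R t ^ ?q * M0 * (B t - A t) ^ (N - 1)"
      unfolding M0 power_mult_distrib by (simp only: mult.assoc)
    finally have *: "z ^ ?q * (B t - A t) ^ (N - 1) =
        (- (h ^ (N - 1) * M0) * R t ^ ?q) * (B t - A t) ^ (N - 1)"
      by (simp only: mult_ac mult_minus_left mult_minus_right)
    have "z ^ ?q = - (h ^ (N - 1) * M0) * R t ^ ?q"
      by (rule mult_right_cancel[THEN iffD1, OF _ *]) (use B(2) in simp)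
    then have "(z / R t) ^ ?q = - (h ^ (N - 1) * M0)"
      using R by (simp add: power_divide)
    moreover have "t = h * (z / R t)\<^sup>2 * ((R t)\<^sup>2 * ?k)"
      using e2 B R by (simp add: field_simps)
    ultimately show "\<exists>c. c ^ ?q = - (h ^ (N - 1) * M0) \<and> z = c * R t \<and>
        t = h * c\<^sup>2 * ((R t)\<^sup>2 * ?k)"
      using R by (intro exI[of _ "z / R t"]) simp
  next
    assume "\<exists>c. c ^ ?q = - (h ^ (N - 1) * M0) \<and> z = c * R t \<and> t = h * c\<^sup>2 * ((R t)\<^sup>2 * ?k)"
    then obtain c where c: "c ^ ?q = - (h ^ (N - 1) * M0)" "z = c * R t" "t = h * c\<^sup>2 * ((R t)\<^sup>2 * ?k)"
      by blast
    have t: "t = h * z\<^sup>2 * ?k"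
      by (subst c(3)) (simp only: c(2) power_mult_distrib mult.assoc)
    have "M0 \<noteq> 0" using M0 B by auto
    then have "c ^ ?q \<noteq> 0" unfolding c(1) using h by simp
    then have "c \<noteq> 0" using N(2) by auto
    then have "z \<noteq> 0" using c(2) R by simp
    moreover have "h * z\<^sup>2 * B t = t * (B t - A t)"
      by (subst (2) t) (simp only: k mult.assoc)
    moreover have "z ^ (n - 1) = - (t ^ (N - 1) * B t)"
    proof -
      have "z ^ (n - 1) = c ^ ?q * (R t ^ ?q) * (z\<^sup>2) ^ (N - 1)"
        unfolding power_split_exponent[OF N] by (simp only: c(2) power_mult_distrib)
      also have "\<dots> = - (h ^ (N - 1) * (R t ^ ?q * M0) * (z\<^sup>2) ^ (N - 1))"
        unfolding c(1) by (simp only: mult_minus_left mult.assoc mult.commute[of M0])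
      also have "\<dots> = - ((h * z\<^sup>2 * ?k) ^ (N - 1) * B t)"
        unfolding M0 power_mult_distrib by (simp only: mult_ac)
      also have "\<dots> = - (t ^ (N - 1) * B t)" by (simp only: flip: t)
      finally show ?thesis .
    qed
    ultimately show "(t, z) \<in> local_system n N A B h" by (simp add: local_system_def)
  }
qed

lemma eventually_roots_small:
  fixes M0 :: complex
  assumes "q > 0" "N \<ge> (2 :: nat)" "\<eta> > 0"
  shows "\<forall>\<^sub>F h in at 0. \<forall>c. c ^ q = - (h ^ (N - 1) * M0) \<longrightarrow> norm c < \<eta>"
proof -
  have "((\<lambda>h :: complex. norm (h ^ (N - 1) * M0)) \<longlongrightarrow> norm (0 ^ (N - 1) * M0)) (at 0)"
    by (intro tendsto_intros)
  then have "\<forall>\<^sub>F h :: complex in at 0. norm (h ^ (N - 1) * M0) < \<eta> ^ q"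
    using assms by (intro order_tendstoD(2)[of _ "norm (0 ^ (N - 1) * M0)"]) (simp_all add: power_0_left)
  then show ?thesis
  proof eventually_elim
    case (elim h)
    show ?case
    proof (intro allI impI)
      fix c assume "c ^ q = - (h ^ (N - 1) * M0)"
      then have "norm c ^ q < \<eta> ^ q" using elim by (simp flip: norm_power)
      then show "norm c < \<eta>" using assms(3) by (simp add: power_less_imp_less_base)
    qed
  qed
qed

lemma card_image_unique_fixed_points:
  fixes q :: nat
  assumes "q > 0" "w \<noteq> 0"
    and "\<And>c. c ^ q = w \<Longrightarrow> \<exists>!t. Q c t" and R: "\<And>t. R t \<noteq> (0 :: complex)"
  shows "finite {(t, c * R t) | t c. c ^ q = w \<and> Q c t}"
    "card {(t, c * R t) | t c. c ^ q = w \<and> Q c t} = q"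
proof -
  define T where "T c = (THE t. Q c t)" for c
  have T: "Q c t \<longleftrightarrow> t = T c" if "c ^ q = w" for c t
    using assms(3)[OF that] theI'[OF assms(3)[OF that]] unfolding T_def by blast
  have eq: "{(t, c * R t) | t c. c ^ q = w \<and> Q c t} = (\<lambda>c. (T c, c * R (T c))) ` {c. c ^ q = w}"
    using T by auto
  have "inj_on (\<lambda>c. (T c, c * R (T c))) {c. c ^ q = w}"
    by (rule inj_onI) (use R in auto)
  then show "card {(t, c * R t) | t c. c ^ q = w \<and> Q c t} = q"
    unfolding eq using assms(1,2) by (simp add: card_image card_nth_roots)
  show "finite {(t, c * R t) | t c. c ^ q = w \<and> Q c t}"
    unfolding eq using assms(1) by (intro finite_imageI finite_nth_roots)
qed

text \<open>For each of the \<open>n + 1 - 2 N\<close> roots \<open>c\<close> the contraction principle gives exactly one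
  solution \<open>t\<close> of the fixed point equation of \<open>local_system_iff_root\<close>, and hence one point
  \<open>(t, c R(t))\<close>. Since \<open>N \<ge> 2\<close>, the roots \<open>c\<close> tend to zero with \<open>h\<close>, so that all these
  points lie in any given smaller neighbourhood.\<close>

lemma local_system_count:
  assumes hol: "A holomorphic_on UNIV" "B holomorphic_on UNIV"
    and B0: "B 0 \<noteq> 0" "B 0 \<noteq> A 0" and N: "2 \<le> N" "2 * N < n + 1"
  obtains W where "open W" "(0, 0) \<in> W"
    "\<And>W'. open W' \<Longrightarrow> (0, 0) \<in> W' \<Longrightarrow> W' \<subseteq> W \<Longrightarrow>
       \<forall>\<^sub>F h in at 0. finite (local_system n N A B h \<inter> W') \<and>
                   card (local_system n N A B h \<inter> W') = n + 1 - 2 * N"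
proof -
  let ?q = "n + 1 - 2 * N"
  have N1: "1 \<le> N" and q: "?q > 0" using N by auto
  have contA: "isCont A 0" and contB: "isCont B 0"
    using hol[THEN holomorphic_on_imp_continuous_on] by (auto simp: continuous_on_eq_continuous_at)
  have "isCont (\<lambda>t. B t * (B t - A t)) 0" using contA contB by (intro continuous_intros)
  then obtain r0 where r0: "r0 > 0" "\<And>t. dist 0 t < r0 \<Longrightarrow> B t * (B t - A t) \<noteq> 0"
    using continuous_at_avoid[of 0 "\<lambda>t. B t * (B t - A t)" 0] B0 by auto
  have nz: "B t \<noteq> 0" "B t \<noteq> A t" if "t \<in> ball 0 r0" for t
    using r0(2)[of t] that by auto
  define k where "k t = B t / (B t - A t)" for t
  define M where "M t = B t * k t ^ (N - 1)" for t
  have holB: "B holomorphic_on ball 0 r0" "A holomorphic_on ball 0 r0"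
    using hol by (auto intro: holomorphic_on_subset)
  have k: "k holomorphic_on ball 0 r0"
    unfolding k_def using nz by (intro holomorphic_intros holB) auto
  have M: "M holomorphic_on ball 0 r0"
    unfolding M_def by (intro holomorphic_intros holB k)
  have M0: "M 0 \<noteq> 0" using B0 by (simp add: M_def k_def)
  obtain r1 R where R: "0 < r1" "r1 \<le> r0" "R holomorphic_on ball 0 r1"
    "\<And>t. t \<in> ball 0 r1 \<Longrightarrow> R t ^ ?q = M t / M 0" "\<And>t. R t \<noteq> 0"
    by (rule holomorphic_power_root_near[OF M r0(1) M0 q]) (rule that)
  define L where "L t = (R t)\<^sup>2 * k t" for t
  have L: "L holomorphic_on ball 0 r1"
    unfolding L_def using R(2) by (intro holomorphic_intros R(3) holomorphic_on_subset[OF k]) auto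
  have half: "0 < r1 / 2" "r1 / 2 < r1" using R(1) by auto
  obtain C1 where C1: "C1 > 0" "\<And>x. x \<in> cball 0 (r1 / 2) \<Longrightarrow> norm (L x) \<le> C1"
    "\<And>x y. x \<in> cball 0 (r1 / 2) \<Longrightarrow> y \<in> cball 0 (r1 / 2) \<Longrightarrow> norm (L x - L y) \<le> C1 * norm (x - y)"
    by (rule holomorphic_imp_Lipschitz_near[OF L half]) (rule that)
  obtain C2 where C2: "C2 > 0" "\<And>x. x \<in> cball 0 (r1 / 2) \<Longrightarrow> norm (R x) \<le> C2"
    "\<And>x y. x \<in> cball 0 (r1 / 2) \<Longrightarrow> y \<in> cball 0 (r1 / 2) \<Longrightarrow> norm (R x - R y) \<le> C2 * norm (x - y)"
    by (rule holomorphic_imp_Lipschitz_near[OF R(3) half]) (rule that)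
  define r where "r = r1 / 2"
  have r: "r > 0" "ball 0 r \<subseteq> ball (0 :: complex) r1" "ball 0 r \<subseteq> ball (0 :: complex) r0"
    using R(1,2) by (auto simp: r_def)
  \<comment> \<open>No bound on \<open>z\<close> is needed: it is determined by \<open>t\<close> and \<open>c\<close>, and tends to zero with \<open>c\<close>.\<close>
  define W where "W = ball (0 :: complex) r \<times> (UNIV :: complex set)"
  define Q where "Q h c t \<longleftrightarrow> t \<in> ball 0 r \<and> t = h * c\<^sup>2 * L t" for h c t
  have sol: "local_system n N A B h \<inter> W =
      {(t, c * R t) | t c. c ^ ?q = - (h ^ (N - 1) * M 0) \<and> Q h c t}" if h: "h \<noteq> 0" for h
  proof -
    have "(t, z) \<in> local_system n N A B h \<longleftrightarrow>
      (\<exists>c. c ^ ?q = - (h ^ (N - 1) * M 0) \<and> z = c * R t \<and> t = h * c\<^sup>2 * L t)"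
      if t: "t \<in> ball 0 r" for t z
    proof -
      have "R t ^ ?q * M 0 = B t * (B t / (B t - A t)) ^ (N - 1)"
        using R(4)[of t] t r(2) M0 by (auto simp: M_def k_def)
      then show ?thesis
        unfolding L_def k_def using t r(3) nz[of t] R(5) h N1 N(2)
        by (intro local_system_iff_root) auto
    qed
    then show ?thesis unfolding W_def Q_def by auto
  qed
  show ?thesis
  proof (rule that[of W])
    show "open W" "(0, 0) \<in> W" using r by (auto simp: W_def intro: open_Times)
  next
    fix W' :: "(complex \<times> complex) set"
    assume W': "open W'" "(0, 0) \<in> W'" "W' \<subseteq> W"
    obtain \<delta> where \<delta>: "\<delta> > 0" "\<And>t z. norm t < \<delta> \<Longrightarrow> norm z < \<delta> \<Longrightarrow> (t, z) \<in> W'"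
    proof -
      obtain U V where UV: "open U" "open V" "(0, 0) \<in> U \<times> V" "U \<times> V \<subseteq> W'"
        using W' by (metis open_prod_elim)
      then obtain d1 d2 where "d1 > 0" "ball 0 d1 \<subseteq> U" "d2 > 0" "ball 0 d2 \<subseteq> V"
        by (metis SigmaD1 SigmaD2 open_contains_ball)
      then show ?thesis using UV(4) by (intro that[of "min d1 d2"]) (auto simp: subset_iff)
    qed
    \<comment> \<open>A bound on the roots \<open>c\<close> that makes the fixed point map a contraction of the disc of radius \<open>r\<close>
      and keeps \<open>t\<close> and \<open>z = c R(t)\<close> below \<open>\<delta>\<close>.\<close>
    define \<eta> where "\<eta> = min 1 (min (r / (2 * C1)) (min (1 / (2 * C1)) (min (\<delta> / (2 * C1)) (\<delta> / (2 * C2)))))"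
    have \<eta>: "\<eta> > 0" "\<eta> \<le> 1" "\<eta> * C1 < r" "\<eta> * C1 < 1" "\<eta> * C1 < \<delta>" "\<eta> * C2 < \<delta>"
    proof -
      have "\<eta> \<le> r / (2 * C1)" "\<eta> \<le> 1 / (2 * C1)" "\<eta> \<le> \<delta> / (2 * C1)" "\<eta> \<le> \<delta> / (2 * C2)"
        by (simp_all add: \<eta>_def)
      then have "\<eta> * C1 * 2 \<le> r" "\<eta> * C1 * 2 \<le> 1" "\<eta> * C1 * 2 \<le> \<delta>" "\<eta> * C2 * 2 \<le> \<delta>"
        using C1(1) C2(1) by (simp_all add: field_simps)
      then show "\<eta> * C1 < r" "\<eta> * C1 < 1" "\<eta> * C1 < \<delta>" "\<eta> * C2 < \<delta>"
        using r(1) \<delta>(1) by linarith+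
      show "\<eta> > 0" "\<eta> \<le> 1" using r(1) \<delta>(1) C1(1) C2(1) by (auto simp: \<eta>_def)
    qed
    have "\<forall>\<^sub>F h :: complex in at 0. h \<noteq> 0 \<and> norm h < 1"
      by (auto simp: eventually_at intro!: exI[of _ 1])
    then show "\<forall>\<^sub>F h in at 0. finite (local_system n N A B h \<inter> W') \<and>
                   card (local_system n N A B h \<inter> W') = ?q"
      using eventually_roots_small[OF q N(1) \<eta>(1), of "M 0"]
    proof eventually_elim
      case (elim h)
      then have h: "h \<noteq> 0" "norm h < 1" and small: "\<And>c. c ^ ?q = - (h ^ (N - 1) * M 0) \<Longrightarrow> norm c < \<eta>"
        by auto
      have eps: "norm (h * c\<^sup>2) \<le> \<eta>" if "c ^ ?q = - (h ^ (N - 1) * M 0)" for c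
      proof -
        have "norm c * norm c \<le> \<eta> * 1"
          using small[OF that] \<eta>(1,2) by (intro mult_mono) auto
        then have "norm h * (norm c * norm c) \<le> 1 * \<eta>"
          using h(2) by (intro mult_mono) auto
        then show ?thesis by (simp add: norm_mult norm_power power2_eq_square)
      qed
      have epsC: "norm (h * c\<^sup>2) * C1 \<le> \<eta> * C1" if "c ^ ?q = - (h ^ (N - 1) * M 0)" for c
        using eps[OF that] C1(1) by (intro mult_right_mono) auto
      have uni: "\<exists>!t. Q h c t" if c: "c ^ ?q = - (h ^ (N - 1) * M 0)" for c
      proof -
        have "norm (h * c\<^sup>2) * C1 < r" "norm (h * c\<^sup>2) * C1 < 1"
          using epsC[OF c] \<eta>(3,4) by linarith+
        then show ?thesis
          unfolding Q_def using r(1) C1 by (intro unique_small_fixed_point[of r L C1]) (auto simp: r_def)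
      qed
      have "local_system n N A B h \<inter> W \<subseteq> W'"
      proof
        fix p assume "p \<in> local_system n N A B h \<inter> W"
        then obtain t c where p: "p = (t, c * R t)" and c: "c ^ ?q = - (h ^ (N - 1) * M 0)"
          and Q: "Q h c t"
          unfolding sol[OF h(1)] by blast
        then have t: "t \<in> cball 0 (r1 / 2)" "t = h * c\<^sup>2 * L t" by (auto simp: Q_def r_def)
        have "norm t \<le> norm (h * c\<^sup>2) * C1"
          by (subst t(2)) (simp only: norm_mult mult_left_mono[OF C1(2)[OF t(1)]] norm_ge_zero mult_nonneg_nonneg)
        also note epsC[OF c]
        also note \<eta>(5)
        finally have "norm t < \<delta>" .
        moreover have "norm (c * R t) \<le> \<eta> * C2"
          unfolding norm_mult using small[OF c] C2(2)[OF t(1)] \<eta>(1) by (intro mult_mono) auto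
        then have "norm (c * R t) < \<delta>" using \<eta>(6) by linarith
        ultimately show "p \<in> W'" using \<delta>(2) p by simp
      qed
      then have "local_system n N A B h \<inter> W' = local_system n N A B h \<inter> W" using W'(3) by blast
      then show ?case
        unfolding sol[OF h(1)]
        using card_image_unique_fixed_points[of ?q "- (h ^ (N - 1) * M 0)" "Q h" R] q h(1) M0 uni R(5)
        by simp
    qed
  qed
qed

section \<open>Ramification numbers of the coordinate points\<close>

text \<open>On a solution with \<open>z \<noteq> 0\<close> the first equation of the system forces \<open>t ^ (N - 1) \<noteq> 0\<close>,
  so this common factor can be cancelled after substituting for \<open>z ^ (n - 1)\<close>.\<close>

lemma chart_equations_iff_local_system:
  fixes t z :: complex
  assumes z: "z \<noteq> 0" and N: "1 \<le> N" and n: "n \<ge> 1"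
    and F: "F = t ^ N * A t" and G: "G = t ^ (N - 1) * B t"
  shows "h * z ^ (n + 1) = t * z ^ (n - 1) + F \<and> z ^ (n - 1) + G = 0 \<longleftrightarrow>
    (t, z) \<in> local_system n N A B h"
proof -
  have tN: "t ^ N = t * t ^ (N - 1)" using N by (cases N) auto
  have zn: "z ^ (n + 1) = z\<^sup>2 * z ^ (n - 1)" using n by (cases n) (auto simp: power2_eq_square)
  have "h * z ^ (n + 1) = t * z ^ (n - 1) + F \<longleftrightarrow> h * z\<^sup>2 * B t = t * (B t - A t)"
    if e: "z ^ (n - 1) = - (t ^ (N - 1) * B t)"
  proof -
    have "t ^ (N - 1) \<noteq> 0"
    proof
      assume "t ^ (N - 1) = 0"
      then have "z ^ (n - 1) = 0" using e by simp
      then show False using z by simp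
    qed
    moreover have "h * z ^ (n + 1) = t * z ^ (n - 1) + F \<longleftrightarrow>
        t ^ (N - 1) * (h * z\<^sup>2 * B t) = t ^ (N - 1) * (t * (B t - A t))"
      unfolding zn e F tN by (auto simp: algebra_simps)
    ultimately show ?thesis by (simp only: mult_cancel_left) simp
  qed
  then show ?thesis
    using z by (auto simp: local_system_def G eq_neg_iff_add_eq_0)
qed

text \<open>The analysis of both coordinate points at infinity, with \<open>N\<close> the multiplicity of the
  point. The equivalence of the ramification equations with the local system is assumed off
  the level \<open>0\<close>, which is avoided by all levels near \<open>h\<close> other than \<open>h\<close> itself.\<close>

lemma ramification_number_chart_origin:
  fixes \<kappa> :: "complex \<times> complex \<Rightarrow> cp2"
  assumes chart: "\<And>W. open W \<Longrightarrow> open (\<kappa> ` W)" "\<And>U. open U \<Longrightarrow> open (\<kappa> -` U)"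
      "\<And>p t z. affine_point p = \<kappa> (t, z) \<longleftrightarrow> z \<noteq> 0 \<and> p = \<alpha> (t, z)"
      "inj_on \<alpha> {w. snd w \<noteq> 0}"
    and hol: "A holomorphic_on UNIV" "B holomorphic_on UNIV"
    and B0: "B 0 \<noteq> 0" "2 \<le> N \<Longrightarrow> B 0 \<noteq> A 0" and N: "1 \<le> N" "2 * N < n + 1"
    and ram: "\<And>h' t z. h' \<noteq> 0 \<Longrightarrow> z \<noteq> 0 \<Longrightarrow>
      \<alpha> (t, z) \<in> ramification_points H h' \<longleftrightarrow> (t, z) \<in> local_system n N A B h'"
  shows "ramification_number H h (\<kappa> (0, 0)) = (if h = 0 \<and> 2 \<le> N then n + 1 - 2 * N else 0)"
proof -
  have sys: "{w \<in> W. snd w \<noteq> 0 \<and> \<alpha> w \<in> ramification_points H h'} = local_system n N A B h' \<inter> W"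
    if "h' \<noteq> 0" for h' W
    using ram[OF that] by (auto simp: local_system_def)
  have nz: "\<forall>\<^sub>F h' in at h. h' \<noteq> 0"
    by (rule eventually_neq_at_within)
  show ?thesis
  proof (cases "h = 0 \<and> 2 \<le> N")
    case True
    then have N2: "2 \<le> N" by simp
    obtain W where W: "open W" "(0, 0) \<in> W"
      "\<And>W'. open W' \<Longrightarrow> (0, 0) \<in> W' \<Longrightarrow> W' \<subseteq> W \<Longrightarrow>
         \<forall>\<^sub>F h in at 0. finite (local_system n N A B h \<inter> W') \<and>
                     card (local_system n N A B h \<inter> W') = n + 1 - 2 * N"
      by (rule local_system_count[OF hol B0(1) B0(2)[OF N2] N2 N(2)]) (rule that)
    have "ramification_number H h (\<kappa> (0, 0)) = n + 1 - 2 * N"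
    proof (rule ramification_number_eq_chartI[where \<kappa> = \<kappa> and \<alpha> = \<alpha>, OF chart W(1,2)])
      fix W' assume W': "open W'" "(0, 0) \<in> W'" "W' \<subseteq> W"
      have "\<forall>\<^sub>F h' in at h. finite (local_system n N A B h' \<inter> W') \<and>
                     card (local_system n N A B h' \<inter> W') = n + 1 - 2 * N"
        using W(3)[OF W'] True by simp
      with nz show "\<forall>\<^sub>F h' in at h.
        finite {w \<in> W'. snd w \<noteq> 0 \<and> \<alpha> w \<in> ramification_points H h'} \<and>
        card {w \<in> W'. snd w \<noteq> 0 \<and> \<alpha> w \<in> ramification_points H h'} = n + 1 - 2 * N"
        by eventually_elim (simp add: sys)
    qed
    then show ?thesis using True by simp
  next
    case False
    have cont: "isCont A 0" "isCont B 0"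
      using hol[THEN holomorphic_on_imp_continuous_on] by (auto simp: continuous_on_eq_continuous_at)
    have N1: "N = 1 \<or> h \<noteq> 0" using False N(1) by auto
    obtain W where W: "open W" "(0, 0) \<in> W"
      "\<forall>\<^sub>F h' in at h. local_system n N A B h' \<inter> W = {}"
      by (rule local_system_no_solutions[OF cont B0(1) N N1]) (rule that)
    have "ramification_number H h (\<kappa> (0, 0)) = 0"
    proof (rule ramification_number_eq_chartI[where \<kappa> = \<kappa> and \<alpha> = \<alpha>, OF chart W(1,2)])
      fix W' assume W': "open W'" "(0, 0) \<in> W'" "W' \<subseteq> W"
      show "\<forall>\<^sub>F h' in at h.
        finite {w \<in> W'. snd w \<noteq> 0 \<and> \<alpha> w \<in> ramification_points H h'} \<and>
        card {w \<in> W'. snd w \<noteq> 0 \<and> \<alpha> w \<in> ramification_points H h'} = 0"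
        using nz W(3)
      proof eventually_elim
        case (elim h')
        then have "local_system n N A B h' \<inter> W' = {}" using W'(3) by blast
        then show ?case using elim(1) by (simp add: sys)
      qed
    qed
    then show ?thesis using False by auto
  qed
qed

lemma sum_powers_at_0: "(\<Sum>i = 0..m. f i * 0 ^ i) = f 0" for f :: "nat \<Rightarrow> complex"
proof -
  have "(\<Sum>i = 0..m. f i * 0 ^ i) = (\<Sum>i = 0..m. if i = 0 then f i else 0)"
    by (intro sum.cong) auto
  then show ?thesis by simp
qed

lemma ramification_number_x_direction:
  assumes N: "1 \<le> N" "2 * N < n + 1" and a: "\<And>i. i < N \<Longrightarrow> a i = 0" "a N \<noteq> 0"
  shows "ramification_number (\<lambda>x y. x * y + binary_form (n + 1) a x y) h (proj_point 1 0 0) =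
    (if h = 0 \<and> 2 \<le> N then n + 1 - 2 * N else 0)"
proof -
  let ?A = "\<lambda>t. \<Sum>i = 0..n + 1 - N. a (i + N) * t ^ i"
  let ?B = "\<lambda>t. \<Sum>i = 0..n + 1 - N. of_nat (i + N) * a (i + N) * t ^ i"
  have "ramification_number (\<lambda>x y. x * y + binary_form (n + 1) a x y) h (chart_x (0, 0)) =
    (if h = 0 \<and> 2 \<le> N then n + 1 - 2 * N else 0)"
  proof (rule ramification_number_chart_origin[OF chart_x_embedding, where A = ?A and B = ?B])
    show "?A holomorphic_on UNIV" "?B holomorphic_on UNIV" by (intro holomorphic_intros)+
    show "?B 0 \<noteq> 0" unfolding sum_powers_at_0 using a(2) N by simp
    show "?B 0 \<noteq> ?A 0" if "2 \<le> N"
      unfolding sum_powers_at_0 using a(2) that by (simp add: mult_cancel_right2)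
    show "1 \<le> N" "2 * N < n + 1" by fact+
    fix h' t z :: complex assume z: "z \<noteq> 0"
    have n1: "n \<ge> 1" and Nn: "N \<le> n + 1" using N by auto
    have "(1 / z, t / z) \<in> ramification_points (\<lambda>x y. x * y + binary_form (n + 1) a x y) h' \<longleftrightarrow>
        h' * z ^ (n + 1) = t * z ^ (n - 1) + t ^ N * ?A t \<and> z ^ (n - 1) + t ^ (N - 1) * ?B t = 0"
      by (simp only: ramification_points_chart_x[OF z n1] binary_form_x_expansion[OF a(1) Nn N(1)])
    also have "\<dots> \<longleftrightarrow> (t, z) \<in> local_system n N ?A ?B h'"
      by (rule chart_equations_iff_local_system[OF z N(1) n1 refl refl])
    finally show "((\<lambda>w. (1 / snd w, fst w / snd w)) (t, z) \<in>
        ramification_points (\<lambda>x y. x * y + binary_form (n + 1) a x y) h') =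
      ((t, z) \<in> local_system n N ?A ?B h')"
      by simp
  qed
  then show ?thesis by (simp add: chart_x_def)
qed

text \<open>In this chart the derivative of the form also carries the full factor \<open>t ^ N\<close>, but its
  companion term has an extra factor \<open>t\<close>, which can be cancelled off the level \<open>0\<close>. The
  leading coefficient of the derivative is \<open>n + 1 - N\<close> times that of the form, and
  \<open>n + 1 - N \<ge> 2\<close>.\<close>

lemma ramification_number_y_direction:
  assumes N: "1 \<le> N" "2 * N < n + 1" and n: "n \<ge> 2"
    and a: "\<And>i. i < N \<Longrightarrow> a (n + 1 - i) = 0" "a (n + 1 - N) \<noteq> 0"
  shows "ramification_number (\<lambda>x y. x * y + binary_form (n + 1) a x y) h (proj_point 0 1 0) =
    (if h = 0 \<and> 2 \<le> N then n + 1 - 2 * N else 0)"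
proof -
  let ?A = "\<lambda>t. \<Sum>i = 0..n + 1 - N. a (n + 1 - (i + N)) * t ^ i"
  let ?B = "\<lambda>t. \<Sum>i = 0..n + 1 - N. of_nat (n + 1 - (i + N)) * a (n + 1 - (i + N)) * t ^ i"
  have d: "n + 1 - N \<ge> 2" using N n by auto
  have "ramification_number (\<lambda>x y. x * y + binary_form (n + 1) a x y) h (chart_y (0, 0)) =
    (if h = 0 \<and> 2 \<le> N then n + 1 - 2 * N else 0)"
  proof (rule ramification_number_chart_origin[OF chart_y_embedding, where A = ?A and B = ?B])
    show "?A holomorphic_on UNIV" "?B holomorphic_on UNIV" by (intro holomorphic_intros)+
    have "of_nat (n + 1 - N) \<noteq> (0 :: complex)" "of_nat (n + 1 - N) \<noteq> (1 :: complex)"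
      using d by (simp_all only: of_nat_eq_0_iff of_nat_eq_1_iff)
    with a(2) show "?B 0 \<noteq> 0" "?B 0 \<noteq> ?A 0"
      unfolding sum_powers_at_0 add_0 by (simp_all only: mult_eq_0_iff mult_cancel_right2 simp_thms)
    show "1 \<le> N" "2 * N < n + 1" by fact+
    fix h' t z :: complex assume h': "h' \<noteq> 0" and z: "z \<noteq> 0"
    have n1: "n \<ge> 1" and Nn: "N \<le> n + 1" using N by auto
    have tN: "t ^ N = t * t ^ (N - 1)" using N(1) by (cases N) auto
    let ?e1 = "h' * z ^ (n + 1) = t * z ^ (n - 1) + t ^ N * ?A t"
    have "(t / z, 1 / z) \<in> ramification_points (\<lambda>x y. x * y + binary_form (n + 1) a x y) h' \<longleftrightarrow>
        ?e1 \<and> t * z ^ (n - 1) + t ^ N * ?B t = 0"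
      by (simp only: ramification_points_chart_y[OF z n1] binary_form_y_expansion[where a = a and d = "n + 1", OF a(1) Nn])
    also have "\<dots> \<longleftrightarrow> ?e1 \<and> t * (z ^ (n - 1) + t ^ (N - 1) * ?B t) = 0"
      unfolding tN by (simp only: distrib_left mult.assoc)
    also have "\<dots> \<longleftrightarrow> ?e1 \<and> z ^ (n - 1) + t ^ (N - 1) * ?B t = 0"
    proof -
      have t0: "t \<noteq> 0" if ?e1
      proof
        assume "t = 0"
        then have "t ^ N = 0" using N(1) by simp
        with that have "h' * z ^ (n + 1) = 0" by (simp only: \<open>t = 0\<close> mult_zero_left add_0)
        then show False using h' z by simp
      qed
      show ?thesis
        by (rule conj_cong[OF refl], drule t0) (simp only: mult_eq_0_iff simp_thms)
    qed
    also have "\<dots> \<longleftrightarrow> (t, z) \<in> local_system n N ?A ?B h'"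
      by (rule chart_equations_iff_local_system[OF z N(1) n1 refl refl])
    finally show "((\<lambda>w. (fst w / snd w, 1 / snd w)) (t, z) \<in>
        ramification_points (\<lambda>x y. x * y + binary_form (n + 1) a x y) h') =
      ((t, z) \<in> local_system n N ?A ?B h')"
      by simp
  qed
  then show ?thesis by (simp add: chart_y_def)
qed

section \<open>Multiplicities of binary forms\<close>

text \<open>Restricted to a line through the point in a transversal direction, the factor
  belonging to the point is a multiple of \<open>s\<close> and all other factors stay away from zero.
  Thus the multiplicity is a vanishing order, independently of the chosen factorization.\<close>

lemma has_multiplicity_along_line:
  assumes "has_multiplicity F (proj_point p q 0) N" and pq: "(p, q) \<noteq> (0, 0)"
    and indep: "p * q' \<noteq> q * p'"
  obtains \<phi> where "isCont \<phi> 0" "\<phi> 0 \<noteq> 0" "\<And>s. F (p + s * p') (q + s * q') = s ^ N * \<phi> s"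
proof -
  from assms(1) show ?thesis
    unfolding has_multiplicity_def
  proof (elim exE conjE, goal_cases)
    case (1 m \<alpha> \<beta> \<nu> i)
    note lin' = 1(1) and np = 1(2) and F = 1(3)[rule_format] and i = 1(4-6)
    obtain c where c: "c \<noteq> 0" "\<beta> i = c * p" "\<alpha> i = c * q"
      using i(2) pq lin'[rule_format, OF i(1)] proj_point_eq_iff[of p q 0 "\<beta> i" "\<alpha> i" 0] by auto
    define \<phi> where "\<phi> s = (\<alpha> i * p' - \<beta> i * q') ^ N *
      (\<Prod>k\<in>{..<m} - {i}. (\<alpha> k * (p + s * p') - \<beta> k * (q + s * q')) ^ \<nu> k)" for s
    show ?thesis
    proof
      show "isCont \<phi> 0" unfolding \<phi>_def by (intro continuous_intros)
      have "\<alpha> i * p' - \<beta> i * q' = c * (q * p' - p * q')" by (simp add: c algebra_simps)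
      then have "\<alpha> i * p' - \<beta> i * q' \<noteq> 0" using c(1) indep by simp
      moreover have "\<alpha> k * p - \<beta> k * q \<noteq> 0" if "k \<in> {..<m} - {i}" for k
      proof
        assume "\<alpha> k * p - \<beta> k * q = 0"
        then have "c * (\<alpha> k * p - \<beta> k * q) = 0" by simp
        then have "\<alpha> k * \<beta> i = \<alpha> i * \<beta> k" by (simp add: c algebra_simps)
        then show False using np i(1) that by auto
      qed
      ultimately show "\<phi> 0 \<noteq> 0" unfolding \<phi>_def by simp
      show "F (p + s * p') (q + s * q') = s ^ N * \<phi> s" for s
      proof -
        have "\<alpha> i * (p + s * p') - \<beta> i * (q + s * q') = s * (\<alpha> i * p' - \<beta> i * q')"
          by (simp add: c algebra_simps)
        then show ?thesis
          unfolding F \<phi>_def using i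
          by (subst prod.remove[of _ i]) (auto simp: power_mult_distrib)
      qed
    qed
  qed
qed

text \<open>Otherwise cancelling \<open>s ^ N\<close> and letting \<open>s\<close> tend to \<open>0\<close> gives \<open>\<phi> 0 = 0\<close>.\<close>

lemma vanishing_exponent_le:
  fixes \<phi> \<psi> :: "complex \<Rightarrow> complex"
  assumes "isCont \<phi> 0" "\<phi> 0 \<noteq> 0" "isCont \<psi> 0"
    and eq: "\<And>s. s ^ N * \<phi> s = s ^ M * \<psi> s"
  shows "M \<le> N"
proof (rule ccontr)
  assume "\<not> M \<le> N"
  then obtain k where M: "M = N + Suc k" by (metis add_Suc_right less_imp_Suc_add not_le)
  have "((\<lambda>s. s * (s ^ k * \<psi> s)) \<longlongrightarrow> 0 * (0 ^ k * \<psi> 0)) (at 0)"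
    using assms(3) by (intro tendsto_intros) (simp add: isCont_def)
  moreover have "\<forall>\<^sub>F s in at 0. s * (s ^ k * \<psi> s) = \<phi> s"
  proof -
    have "s * (s ^ k * \<psi> s) = \<phi> s" if "s \<noteq> 0" for s
    proof -
      have "s ^ N * (s * (s ^ k * \<psi> s)) = s ^ N * \<phi> s"
        unfolding eq M by (simp add: power_add mult_ac)
      then show ?thesis using that by simp
    qed
    then show ?thesis
      using eventually_neq_at_within[of "0 :: complex" 0 UNIV] by (auto elim!: eventually_mono)
  qed
  ultimately have "(\<phi> \<longlongrightarrow> 0) (at 0)" by (simp add: tendsto_cong)
  then show False
    using assms(1,2) LIM_unique by (auto simp: isCont_def)
qed

lemma exists_complex_power_root:
  fixes w :: complex
  assumes "q > 0"
  obtains c where "c ^ q = w"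
proof (cases "w = 0")
  case False
  then have "card {z. z ^ q = w} \<noteq> 0" using assms by (simp add: card_nth_roots)
  then have "{z. z ^ q = w} \<noteq> {}" by (metis card.empty)
  then show ?thesis using that by blast
qed (use assms that[of 0] in auto)

lemma proj_point_at_infinity_eqI:
  assumes "\<alpha> * p = \<beta> * q" "(\<alpha>, \<beta>) \<noteq> (0, 0)" "(p, q) \<noteq> (0, 0)"
  shows "proj_point p q 0 = proj_point \<beta> \<alpha> 0"
proof -
  have "\<exists>c. c \<noteq> 0 \<and> \<beta> = c * p \<and> \<alpha> = c * q"
  proof (cases "p = 0")
    case True
    then show ?thesis using assms by (intro exI[of _ "\<alpha> / q"]) auto
  next
    case False
    then have "\<alpha> = \<beta> / p * q" using assms(1) by (simp add: field_simps)
    then show ?thesis using False assms(2) by (intro exI[of _ "\<beta> / p"]) auto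
  qed
  then show ?thesis using assms by (subst proj_point_eq_iff) auto
qed

text \<open>The definition allows no scalar in front of the product, so the scalar is absorbed
  into one linear factor by means of a complex root; the factors are then numbered.\<close>

lemma has_multiplicity_of_factorization:
  fixes I :: "'i set"
  assumes I: "finite I" "I \<noteq> {}"
    and lin: "\<And>i. i \<in> I \<Longrightarrow> (\<alpha> i, \<beta> i) \<noteq> (0, 0)" "\<And>i. i \<in> I \<Longrightarrow> \<nu> i \<ge> 1"
    and np: "\<And>i k. i \<in> I \<Longrightarrow> k \<in> I \<Longrightarrow> i \<noteq> k \<Longrightarrow> \<alpha> i * \<beta> k \<noteq> \<alpha> k * \<beta> i"
    and F: "\<And>x y. F x y = l * (\<Prod>i\<in>I. (\<alpha> i * x - \<beta> i * y) ^ \<nu> i)" and l: "l \<noteq> 0"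
    and pq: "F p q = 0" "(p, q) \<noteq> (0, 0)"
  shows "\<exists>N. has_multiplicity F (proj_point p q 0) N"
proof -
  obtain i0 where i0: "i0 \<in> I" using I(2) by blast
  obtain c where c: "c ^ \<nu> i0 = l" using exists_complex_power_root[of "\<nu> i0" l] lin(2)[OF i0] by auto
  have c0: "c \<noteq> 0" using c l lin(2)[OF i0] by (auto simp: power_0_left)
  \<comment> \<open>The scalars of the linear forms: a root of \<open>l\<close> for the chosen factor, \<open>1\<close> for the others.\<close>
  define e where "e i = (if i = i0 then c else 1)" for i
  have e0: "e i \<noteq> 0" for i using c0 by (simp add: e_def)
  have F': "F x y = (\<Prod>i\<in>I. (e i * \<alpha> i * x - e i * \<beta> i * y) ^ \<nu> i)" for x y
  proof -
    have "(\<Prod>i\<in>I. (e i * \<alpha> i * x - e i * \<beta> i * y) ^ \<nu> i) =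
        (\<Prod>i\<in>I. e i ^ \<nu> i * (\<alpha> i * x - \<beta> i * y) ^ \<nu> i)"
      by (simp add: power_mult_distrib[symmetric] right_diff_distrib mult.assoc)
    also have "\<dots> = (\<Prod>i\<in>I. e i ^ \<nu> i) * (\<Prod>i\<in>I. (\<alpha> i * x - \<beta> i * y) ^ \<nu> i)"
      by (rule prod.distrib)
    also have "(\<Prod>i\<in>I. e i ^ \<nu> i) = l"
      using I(1) i0 c by (subst prod.remove[OF I(1) i0]) (simp add: e_def)
    finally show ?thesis by (simp add: F)
  qed
  obtain g where g: "bij_betw g {..<card I} I"
    using ex_bij_betw_nat_finite[OF I(1)] by (auto simp: atLeast0LessThan)
  have gI: "g i \<in> I" if "i < card I" for i using g that by (auto dest: bij_betwE)
  have "l * (\<Prod>i\<in>I. (\<alpha> i * p - \<beta> i * q) ^ \<nu> i) = 0" using pq(1) F by simp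
  then obtain i1 where i1: "i1 \<in> I" "\<alpha> i1 * p = \<beta> i1 * q"
    using I(1) l by auto
  obtain k1 where k1: "k1 < card I" "g k1 = i1"
    using g i1(1) by (metis bij_betw_def imageE lessThan_iff)
  show ?thesis
    unfolding has_multiplicity_def
  proof (intro exI conjI)
    show "\<forall>i<card I. (e (g i) * \<alpha> (g i), e (g i) * \<beta> (g i)) \<noteq> (0, 0) \<and> \<nu> (g i) \<ge> 1"
      using lin gI e0 by simp
    show "\<forall>i<card I. \<forall>k<card I. i \<noteq> k \<longrightarrow>
        e (g i) * \<alpha> (g i) * (e (g k) * \<beta> (g k)) \<noteq> e (g k) * \<alpha> (g k) * (e (g i) * \<beta> (g i))"
    proof (intro allI impI)
      fix i k assume ik: "i < card I" "k < card I" "i \<noteq> k"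
      then have "g i \<noteq> g k" using g by (auto simp: bij_betw_def inj_on_def)
      then have "e (g i) * e (g k) * (\<alpha> (g i) * \<beta> (g k)) \<noteq> e (g i) * e (g k) * (\<alpha> (g k) * \<beta> (g i))"
        using np gI ik e0 by simp
      moreover have "e (g i) * \<alpha> (g i) * (e (g k) * \<beta> (g k)) = e (g i) * e (g k) * (\<alpha> (g i) * \<beta> (g k))"
        "e (g k) * \<alpha> (g k) * (e (g i) * \<beta> (g i)) = e (g i) * e (g k) * (\<alpha> (g k) * \<beta> (g i))"
        by (simp_all add: mult_ac)
      ultimately show "e (g i) * \<alpha> (g i) * (e (g k) * \<beta> (g k)) \<noteq> e (g k) * \<alpha> (g k) * (e (g i) * \<beta> (g i))"
        by (simp only: not_False_eq_True)
    qed
    show "\<forall>x y. F x y =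
        (\<Prod>i<card I. (e (g i) * \<alpha> (g i) * x - e (g i) * \<beta> (g i) * y) ^ \<nu> (g i))"
      unfolding F' by (intro allI) (rule prod.reindex_bij_betw[OF g, symmetric])
    show "k1 < card I" by (rule k1)
    show "proj_point p q 0 = proj_point (e (g k1) * \<beta> (g k1)) (e (g k1) * \<alpha> (g k1)) 0"
      using i1 k1 lin(1)[OF i1(1)] e0 pq(2)
      by (intro proj_point_at_infinity_eqI) auto
    show "\<nu> i1 = \<nu> (g k1)" using k1 by simp
  qed
qed

text \<open>Homogenizing the factorization of \<open>f(t) = F(1, t)\<close> over its roots; the missing degree
  \<open>d - degree f\<close> is the exponent of the factor \<open>x\<close>, that is, the multiplicity of
  \<open>[0 : 1 : 0]\<close>.\<close>

lemma binary_form_factorization: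
  fixes a :: "nat \<Rightarrow> complex" and d :: nat
  defines "f \<equiv> (\<Sum>j = 0..d. monom (a j) j)"
  shows "binary_form d a x y = lead_coeff f * x ^ (d - degree f) *
     (\<Prod>z | poly f z = 0. (y - z * x) ^ order z f)"
    and "poly f t = binary_form d a 1 t" and "degree f \<le> d"
    and "f \<noteq> 0 \<Longrightarrow> degree f = (\<Sum>z | poly f z = 0. order z f)"
proof -
  show le: "degree f \<le> d"
    unfolding f_def
  proof (rule degree_sum_le)
    show "degree (monom (a j) j) \<le> d" if "j \<in> {0..d}" for j
      using degree_monom_le[of "a j" j] that by simp
  qed simp
  show poly_f: "poly f t = binary_form d a 1 t" for t
    by (simp add: f_def poly_sum poly_monom binary_form_def)
  have coeff_f: "coeff f d = a d" by (simp add: f_def coeff_sum)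
  show deg: "degree f = (\<Sum>z | poly f z = 0. order z f)" if "f \<noteq> 0"
  proof -
    have "degree f = degree (\<Prod>z | poly f z = 0. [:- z, 1:] ^ order z f)"
      using arg_cong[OF complex_poly_decompose[of f], of degree] that
      by (simp only: degree_smult_eq leading_coeff_0_iff if_False)
    also have "\<dots> = (\<Sum>z | poly f z = 0. degree ([:- z, 1:] ^ order z f))"
      by (rule degree_prod_eq_sum_degree)
        (intro ballI power_not_zero, simp only: pCons_eq_0_iff one_neq_zero simp_thms)
    also have "\<dots> = (\<Sum>z | poly f z = 0. order z f)"
      by (intro sum.cong) (simp_all add: degree_power_eq)
    finally show ?thesis .
  qed
  have dec: "poly f t = lead_coeff f * (\<Prod>z | poly f z = 0. (t - z) ^ order z f)" for t
  proof -
    have "poly f t = poly (smult (lead_coeff f) (\<Prod>z | poly f z = 0. [:- z, 1:] ^ order z f)) t"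
      by (simp only: complex_poly_decompose)
    then show ?thesis by (simp add: poly_prod)
  qed
  show "binary_form d a x y = lead_coeff f * x ^ (d - degree f) *
     (\<Prod>z | poly f z = 0. (y - z * x) ^ order z f)"
  proof (cases "f = 0")
    case True
    then have "a j = 0" if "j \<le> d" for j
    proof -
      have "coeff f j = a j" using that by (simp add: f_def coeff_sum)
      then show ?thesis using True by simp
    qed
    then show ?thesis using True by (simp add: binary_form_def)
  next
    case nz: False
    show ?thesis
    proof (cases "x = 0")
      case True
      have "binary_form d a x y = (\<Sum>j = 0..d. if j = d then a d * y ^ d else 0)"
        unfolding binary_form_def True by (intro sum.cong) (auto simp: power_0_left)
      also have "\<dots> = a d * y ^ d" by simp
      finally have L: "binary_form d a x y = a d * y ^ d" .
      have R: "(\<Prod>z | poly f z = 0. (y - z * x) ^ order z f) = y ^ degree f"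
        unfolding deg[OF nz] power_sum using True by simp
      show ?thesis
      proof (cases "degree f = d")
        case eq: True
        then have "lead_coeff f = a d" using coeff_f by simp
        then show ?thesis unfolding L R eq by simp
      next
        case False
        then have lt: "degree f < d" using le by simp
        then have "a d = 0" using coeff_f coeff_eq_0 by metis
        moreover have "x ^ (d - degree f) = 0" using True lt by (simp add: power_0_left)
        ultimately show ?thesis unfolding L by simp
      qed
    next
      case False
      have "binary_form d a x y = x ^ d * poly f (y / x)"
        using binary_form_scale[of d a x 1 "y / x"] False by (simp add: poly_f)
      also have "\<dots> = lead_coeff f * x ^ (d - degree f) *
          (x ^ degree f * (\<Prod>z | poly f z = 0. (y / x - z) ^ order z f))"
      proof -
        have "x ^ d = x ^ (d - degree f) * x ^ degree f" using le by (simp flip: power_add)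
        then show ?thesis by (simp only: dec[of "y / x"] mult_ac)
      qed
      also have "x ^ degree f * (\<Prod>z | poly f z = 0. (y / x - z) ^ order z f) =
          (\<Prod>z | poly f z = 0. (y - z * x) ^ order z f)"
        unfolding deg[OF nz] power_sum prod.distrib[symmetric] power_mult_distrib[symmetric]
        using False by (intro prod.cong refl arg_cong[where f = "\<lambda>u. u ^ _"]) (simp add: right_diff_distrib mult.commute)
      finally show ?thesis .
    qed
  qed
qed

text \<open>The linear factors are indexed by the roots \<open>z\<close> of the dehomogenized form, with \<open>None\<close>
  standing for the factor \<open>x\<close>, the root at infinity.\<close>

lemma has_multiplicity_exists:
  assumes d: "d \<ge> 1" and a: "j \<le> d" "a j \<noteq> 0"
    and pq: "binary_form d a p q = 0" "(p, q) \<noteq> (0, 0)"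
  shows "\<exists>N. has_multiplicity (binary_form d a) (proj_point p q 0) N"
proof -
  define f where "f = (\<Sum>j = 0..d. monom (a j) j)"
  note fact = binary_form_factorization[where d = d and a = a, folded f_def]
  have "coeff f j = a j" using a by (simp add: f_def coeff_sum)
  then have f0: "f \<noteq> 0" using a by auto
  define I where "I = Some ` {z. poly f z = 0} \<union> (if degree f < d then {None} else {})"
  define \<alpha> :: "complex option \<Rightarrow> complex" where "\<alpha> i = (case i of None \<Rightarrow> 1 | Some z \<Rightarrow> - z)" for i
  define \<beta> :: "complex option \<Rightarrow> complex" where "\<beta> i = (case i of None \<Rightarrow> 0 | Some z \<Rightarrow> - 1)" for i
  define \<nu> where "\<nu> i = (case i of None \<Rightarrow> d - degree f | Some z \<Rightarrow> order z f)" for i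
  have fin: "finite {z. poly f z = 0}" using f0 by (rule poly_roots_finite)
  show ?thesis
  proof (rule has_multiplicity_of_factorization[where I = I and \<alpha> = \<alpha> and \<beta> = \<beta> and \<nu> = \<nu>])
    show "finite I" using fin by (simp add: I_def)
    show "I \<noteq> {}"
    proof
      assume "I = {}"
      then have "{z. poly f z = 0} = {}" "\<not> degree f < d" by (auto simp: I_def split: if_splits)
      then show False using fact(4)[OF f0] d by simp
    qed
    show "(\<alpha> i, \<beta> i) \<noteq> (0, 0)" for i by (cases i) (auto simp: \<alpha>_def \<beta>_def)
    show "\<nu> i \<ge> 1" if "i \<in> I" for i
      using that f0 by (auto simp: I_def \<nu>_def Suc_le_eq order_gt_0_iff split: if_splits)
    show "\<alpha> i * \<beta> k \<noteq> \<alpha> k * \<beta> i" if "i \<noteq> k" for i k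
      using that by (cases i; cases k) (auto simp: \<alpha>_def \<beta>_def)
    show "lead_coeff f \<noteq> 0" using f0 by simp
    show "binary_form d a p q = 0" "(p, q) \<noteq> (0, 0)" by fact+
    show "binary_form d a x y = lead_coeff f * (\<Prod>i\<in>I. (\<alpha> i * x - \<beta> i * y) ^ \<nu> i)" for x y
    proof -
      have S: "(\<Prod>i\<in>Some ` {z. poly f z = 0}. (\<alpha> i * x - \<beta> i * y) ^ \<nu> i) =
          (\<Prod>z | poly f z = 0. (y - z * x) ^ order z f)"
        by (subst prod.reindex) (auto simp: \<alpha>_def \<beta>_def \<nu>_def)
      show ?thesis
      proof (cases "degree f < d")
        case True
        then have "I = insert None (Some ` {z. poly f z = 0})" by (simp add: I_def)
        then have "(\<Prod>i\<in>I. (\<alpha> i * x - \<beta> i * y) ^ \<nu> i) = (\<alpha> None * x - \<beta> None * y) ^ \<nu> None *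
            (\<Prod>i\<in>Some ` {z. poly f z = 0}. (\<alpha> i * x - \<beta> i * y) ^ \<nu> i)"
          using fin by (subst prod.insert[symmetric]) auto
        also have "\<dots> = x ^ (d - degree f) * (\<Prod>z | poly f z = 0. (y - z * x) ^ order z f)"
          unfolding S by (simp add: \<alpha>_def \<beta>_def \<nu>_def)
        finally have "(\<Prod>i\<in>I. (\<alpha> i * x - \<beta> i * y) ^ \<nu> i) =
            x ^ (d - degree f) * (\<Prod>z | poly f z = 0. (y - z * x) ^ order z f)" .
        then show ?thesis by (simp add: fact(1) mult.assoc)
      next
        case False
        then have "I = Some ` {z. poly f z = 0}" "d - degree f = 0" by (simp_all add: I_def)
        then show ?thesis by (simp add: fact(1) S)
      qed
    qed
  qed
qed

lemma multiplicity_eq_vanishing_exponent: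
  assumes "has_multiplicity F (proj_point p q 0) N" "(p, q) \<noteq> (0, 0)" "p * q' \<noteq> q * p'"
    and "isCont \<psi> 0" "\<psi> 0 \<noteq> 0" "\<And>s. F (p + s * p') (q + s * q') = s ^ M * \<psi> s"
  shows "N = M"
proof -
  obtain \<phi> where "isCont \<phi> 0" "\<phi> 0 \<noteq> 0" "\<And>s. F (p + s * p') (q + s * q') = s ^ N * \<phi> s"
    by (rule has_multiplicity_along_line[OF assms(1-3)]) (rule that)
  then show ?thesis
    using assms(4-6) by (intro antisym vanishing_exponent_le[of \<phi> \<psi>] vanishing_exponent_le[of \<psi> \<phi>]) simp_all
qed

section \<open>Ramification numbers of the other points at infinity\<close>

lemma poly_pderiv_dehomogenization:
  "poly (pderiv (\<Sum>j = 0..d. monom (a j) j)) t = binary_form_dy d a 1 t"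
proof -
  have "((\<lambda>t. 1 * t + binary_form d a 1 t) has_field_derivative
      1 + poly (pderiv (\<Sum>j = 0..d. monom (a j) j)) t) (at t)"
    unfolding binary_form_factorization(2)[symmetric]
    by (intro derivative_eq_intros poly_DERIV) auto
  from DERIV_unique[OF this binary_form_has_derivative] show ?thesis by simp
qed

text \<open>Write \<open>F(1, t) = (t - t\<^sub>0) ^ (k + 1) p(t)\<close> and \<open>F\<^sub>y(1, t) = (t - t\<^sub>0) ^ k g(t)\<close>.
  Eliminating \<open>z ^ (n - 1)\<close> gives \<open>h z\<^sup>2 g(t) = t g(t) - (t - t\<^sub>0) p(t)\<close> at every
  ramification point. At \<open>z = 0\<close>, \<open>t = t\<^sub>0\<close> the two sides are \<open>0\<close> and \<open>t\<^sub>0 g(t\<^sub>0) \<noteq> 0\<close>, so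
  the level tends to infinity along ramification points approaching such a point.\<close>

lemma ramification_number_other_directions:
  assumes n: "n \<ge> 1" and a: "j \<le> n + 1" "a j \<noteq> 0"
    and t0: "t0 \<noteq> 0" "binary_form (n + 1) a 1 t0 = 0"
  shows "ramification_number (\<lambda>x y. x * y + binary_form (n + 1) a x y) h (proj_point 1 t0 0) = 0"
proof -
  let ?H = "\<lambda>x y. x * y + binary_form (n + 1) a x y"
  define f where "f = (\<Sum>j = 0..n + 1. monom (a j) j)"
  have poly_f: "poly f t = binary_form (n + 1) a 1 t"
    and poly_f': "poly (pderiv f) t = binary_form_dy (n + 1) a 1 t" for t
    unfolding f_def by (rule binary_form_factorization(2), rule poly_pderiv_dehomogenization)
  have "coeff f j = a j" using a by (simp add: f_def coeff_sum)
  then have f0: "f \<noteq> 0" using a by auto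
  obtain p where p: "f = [:- t0, 1:] ^ order t0 f * p" "\<not> [:- t0, 1:] dvd p"
    using order_decomp[OF f0] by blast
  have p0: "poly p t0 \<noteq> 0" using p(2) by (simp add: poly_eq_0_iff_dvd)
  have "order t0 f \<noteq> 0" using f0 t0(2) poly_f[of t0] by (simp add: order_root)
  then obtain k where k: "order t0 f = Suc k" by (cases "order t0 f") auto
  define g where "g t = (t - t0) * poly (pderiv p) t + of_nat (Suc k) * poly p t" for t
  have F: "binary_form (n + 1) a 1 t = (t - t0) ^ k * ((t - t0) * poly p t)" for t
    unfolding poly_f[symmetric] by (subst p(1)) (simp add: k algebra_simps)
  have G: "binary_form_dy (n + 1) a 1 t = (t - t0) ^ k * g t" for t
    unfolding poly_f'[symmetric]
  proof -
    have "pderiv f = [:- t0, 1:] ^ Suc k * pderiv p + smult (of_nat (Suc k)) (p * [:- t0, 1:] ^ k)"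
      unfolding lemma_order_pderiv1[symmetric] using p(1) k by simp
    then have "poly (pderiv f) t =
        (t - t0) ^ Suc k * poly (pderiv p) t + of_nat (Suc k) * (poly p t * (t - t0) ^ k)"
      by (simp del: of_nat_Suc power_Suc)
    then show "poly (pderiv f) t = (t - t0) ^ k * g t"
      by (simp add: g_def algebra_simps del: of_nat_Suc)
  qed
  let ?\<Phi> = "\<lambda>w :: complex \<times> complex \<times> complex. fst w * (snd (snd w))\<^sup>2 * g (fst (snd w)) -
    (fst (snd w) * g (fst (snd w)) - (fst (snd w) - t0) * poly p (fst (snd w)))"
  have "isCont ?\<Phi> (h, t0, 0)"
    unfolding g_def by (intro continuous_intros)
  moreover have "?\<Phi> (h, t0, 0) \<noteq> 0"
    using t0 p0 by (simp add: g_def del: of_nat_Suc)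
  ultimately obtain W where W: "open W" "(t0, 0) \<in> W" "\<forall>\<^sub>F h' in at h. \<forall>w\<in>W. ?\<Phi> (h', w) \<noteq> 0"
    by (rule nonvanishing_nearby)
  have zero: "?\<Phi> (h', (t, z)) = 0" if z: "z \<noteq> 0" and r: "(1 / z, t / z) \<in> ramification_points ?H h'"
    for h' t z
  proof -
    have e1: "h' * z ^ (n + 1) = t * z ^ (n - 1) + (t - t0) ^ k * ((t - t0) * poly p t)"
      and e2: "z ^ (n - 1) = - ((t - t0) ^ k * g t)"
      using r unfolding ramification_points_chart_x[OF z n] F G by (auto simp: eq_neg_iff_add_eq_0)
    have "(t - t0) ^ k \<noteq> 0"
    proof
      assume "(t - t0) ^ k = 0"
      then have "z ^ (n - 1) = 0" using e2 by simp
      then show False using z by simp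
    qed
    moreover have "z ^ (n + 1) = z\<^sup>2 * z ^ (n - 1)"
      using n by (cases n) (auto simp: power2_eq_square)
    with e1 have "(t - t0) ^ k * (h' * z\<^sup>2 * g t - (t * g t - (t - t0) * poly p t)) = 0"
      unfolding e2 by (simp add: algebra_simps)
    ultimately show ?thesis by (simp only: mult_eq_0_iff simp_thms fst_conv snd_conv)
  qed
  have "ramification_number ?H h (chart_x (t0, 0)) = 0"
  proof (rule ramification_number_eq_chartI[OF chart_x_embedding W(1,2)])
    fix W' assume W': "open W'" "(t0, 0) \<in> W'" "W' \<subseteq> W"
    show "\<forall>\<^sub>F h' in at h.
      finite {w \<in> W'. snd w \<noteq> 0 \<and> (\<lambda>w. (1 / snd w, fst w / snd w)) w \<in> ramification_points ?H h'} \<and>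
      card {w \<in> W'. snd w \<noteq> 0 \<and> (\<lambda>w. (1 / snd w, fst w / snd w)) w \<in> ramification_points ?H h'} = 0"
      using W(3)
    proof eventually_elim
      case (elim h')
      have "{w \<in> W'. snd w \<noteq> 0 \<and> (1 / snd w, fst w / snd w) \<in> ramification_points ?H h'} = {}"
      proof -
        have False if w: "w \<in> W'" "snd w \<noteq> 0" "(1 / snd w, fst w / snd w) \<in> ramification_points ?H h'" for w
          using zero[OF w(2,3)] elim w(1) W'(3) by (metis prod.collapse subsetD)
        then show ?thesis by blast
      qed
      then show ?case by (simp only: finite.emptyI card.empty simp_thms)
    qed
  qed
  then show ?thesis by (simp add: chart_x_def)
qed

section \<open>The characterization of nonzero ramification numbers\<close>

text \<open>The multiplicity of \<open>[1 : 0 : 0]\<close> is the smallest index of a nonzero coefficient. The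
  given index \<open>j\<close> bounds it by less than half the degree.\<close>

lemma ramification_number_x_direction_nonzero_iff:
  assumes j: "real j < (real n + 1) / 2" "a j \<noteq> 0"
    and root: "binary_form (n + 1) a 1 0 = 0"
  shows "ramification_number (\<lambda>x y. x * y + binary_form (n + 1) a x y) h (proj_point 1 0 0) \<noteq> 0 \<longleftrightarrow>
    h = 0 \<and> (\<exists>N. has_multiplicity (binary_form (n + 1) a) (proj_point 1 0 0) N \<and>
      1 < N \<and> real N < (real n + 1) / 2)"
proof -
  define N where "N = (LEAST j. a j \<noteq> 0)"
  have aN: "a N \<noteq> 0" unfolding N_def by (rule LeastI[of "\<lambda>j. a j \<noteq> 0", OF j(2)])
  have below: "a i = 0" if "i < N" for i using not_less_Least that unfolding N_def by blast
  have Nj: "N \<le> j" unfolding N_def by (rule Least_le) (rule j(2))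
  then have Nreal: "real N < (real n + 1) / 2" using j(1) by (meson le_less_trans of_nat_le_iff)
  then have N2: "2 * N < n + 1" by simp
  have "a 0 = 0" using root by (simp add: binary_form_def sum_powers_at_0)
  then have N1: "1 \<le> N" using aN by (cases N) auto
  have mult: "N' = N" if N': "has_multiplicity (binary_form (n + 1) a) (proj_point 1 0 0) N'" for N'
  proof (rule multiplicity_eq_vanishing_exponent[OF N'])
    show "(1, 0) \<noteq> (0 :: complex, 0 :: complex)" "1 * 1 \<noteq> 0 * (0 :: complex)" by simp_all
    let ?\<psi> = "\<lambda>s. \<Sum>i = 0..n + 1 - N. a (i + N) * s ^ i"
    show "isCont ?\<psi> 0" by (intro continuous_intros)
    show "?\<psi> 0 \<noteq> 0" unfolding sum_powers_at_0 using aN by simp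
    show "binary_form (n + 1) a (1 + s * 0) (0 + s * 1) = s ^ N * ?\<psi> s" for s
      using binary_form_x_expansion(1)[of N a "n + 1" s] below N1 N2 by simp
  qed
  obtain N' where "has_multiplicity (binary_form (n + 1) a) (proj_point 1 0 0) N'"
    using has_multiplicity_exists[of "n + 1" N a 1 0] N2 aN root by auto
  then have ex: "has_multiplicity (binary_form (n + 1) a) (proj_point 1 0 0) N" using mult by metis
  have "(\<exists>N. has_multiplicity (binary_form (n + 1) a) (proj_point 1 0 0) N \<and>
      1 < N \<and> real N < (real n + 1) / 2) \<longleftrightarrow> 2 \<le> N"
  proof
    assume "2 \<le> N"
    then show "\<exists>N. has_multiplicity (binary_form (n + 1) a) (proj_point 1 0 0) N \<and>
      1 < N \<and> real N < (real n + 1) / 2" using ex Nreal by (intro exI[of _ N]) auto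
  qed (use mult in force)
  then show ?thesis
    using ramification_number_x_direction[where a = a, OF N1 N2 below aN, of h] N2 by simp
qed

text \<open>Symmetrically, the multiplicity of \<open>[0 : 1 : 0]\<close> is \<open>n + 1\<close> minus the largest index of
  a nonzero coefficient of the form, which is at least \<open>k\<close>.\<close>

lemma ramification_number_y_direction_nonzero_iff:
  assumes n: "n \<ge> 2" and k: "(real n + 1) / 2 < real k" "k \<le> n + 1" "a k \<noteq> 0"
    and root: "binary_form (n + 1) a 0 1 = 0"
  shows "ramification_number (\<lambda>x y. x * y + binary_form (n + 1) a x y) h (proj_point 0 1 0) \<noteq> 0 \<longleftrightarrow>
    h = 0 \<and> (\<exists>N. has_multiplicity (binary_form (n + 1) a) (proj_point 0 1 0) N \<and>
      1 < N \<and> real N < (real n + 1) / 2)"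
proof -
  define N where "N = (LEAST i. a (n + 1 - i) \<noteq> 0)"
  have k': "a (n + 1 - (n + 1 - k)) \<noteq> 0" using k by simp
  have aN: "a (n + 1 - N) \<noteq> 0"
    unfolding N_def by (rule LeastI[of "\<lambda>i. a (n + 1 - i) \<noteq> 0", OF k'])
  have below: "a (n + 1 - i) = 0" if "i < N" for i using not_less_Least that unfolding N_def by blast
  have Nk: "N \<le> n + 1 - k" unfolding N_def by (rule Least_le) (rule k')
  then have "N + k \<le> n + 1" using k(2) by simp
  then have "real N + real k \<le> real n + 1"
    using k(2) by simp
  then have Nreal: "real N < (real n + 1) / 2" using k(1) by (simp add: field_simps)
  then have N2: "2 * N < n + 1" by simp
  have expansion: "binary_form (n + 1) a s 1 = s ^ N * (\<Sum>i = 0..n + 1 - N. a (n + 1 - (i + N)) * s ^ i)" for s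
    using below N2 by (intro binary_form_y_expansion(1)) auto
  have N1: "1 \<le> N"
  proof (rule ccontr)
    assume "\<not> 1 \<le> N"
    then have "N = 0" by simp
    then have "a (n + 1) = 0" using expansion[of 0] root by (simp only: sum_powers_at_0) simp
    then show False using aN \<open>N = 0\<close> by simp
  qed
  have mult: "N' = N" if N': "has_multiplicity (binary_form (n + 1) a) (proj_point 0 1 0) N'" for N'
  proof (rule multiplicity_eq_vanishing_exponent[OF N'])
    show "(0, 1) \<noteq> (0 :: complex, 0 :: complex)" "0 * 0 \<noteq> 1 * (1 :: complex)" by simp_all
    let ?\<psi> = "\<lambda>s. \<Sum>i = 0..n + 1 - N. a (n + 1 - (i + N)) * s ^ i"
    show "isCont ?\<psi> 0" by (intro continuous_intros)
    show "?\<psi> 0 \<noteq> 0" unfolding sum_powers_at_0 using aN by simp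
    show "binary_form (n + 1) a (0 + s * 1) (1 + s * 0) = s ^ N * ?\<psi> s" for s
      using expansion[of s] by simp
  qed
  obtain N' where "has_multiplicity (binary_form (n + 1) a) (proj_point 0 1 0) N'"
    using has_multiplicity_exists[of "n + 1" "n + 1 - N" a 0 1] aN root by auto
  then have ex: "has_multiplicity (binary_form (n + 1) a) (proj_point 0 1 0) N" using mult by metis
  have "(\<exists>N. has_multiplicity (binary_form (n + 1) a) (proj_point 0 1 0) N \<and>
      1 < N \<and> real N < (real n + 1) / 2) \<longleftrightarrow> 2 \<le> N"
  proof
    assume "2 \<le> N"
    then show "\<exists>N. has_multiplicity (binary_form (n + 1) a) (proj_point 0 1 0) N \<and>
      1 < N \<and> real N < (real n + 1) / 2" using ex Nreal by (intro exI[of _ N]) auto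
  qed (use mult in force)
  then show ?thesis
    using ramification_number_y_direction[where a = a, OF N1 N2 n below aN, of h] N2 by simp
qed

theorem theorem5:
  fixes n j k :: nat and a :: "nat \<Rightarrow> complex" and h :: complex and P :: cp2
    and H :: "complex \<Rightarrow> complex \<Rightarrow> complex"
  assumes "n \<ge> 2"
    and "H = (\<lambda>x y. x * y + binary_form (n + 1) a x y)"
    and "real j < (real n + 1) / 2" and "(real n + 1) / 2 < real k" and "k \<le> n + 1"
    and "a j * a k \<noteq> 0"
    and "P \<in> points_at_infinity H h"
  shows "ramification_number H h P \<noteq> 0 \<longleftrightarrow>
    h = 0 \<and> (P = proj_point 1 0 0 \<or> P = proj_point 0 1 0) \<and>
    (\<exists>N. has_multiplicity (binary_form (n + 1) a) P N \<and> 1 < N \<and> real N < (real n + 1) / 2)"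
proof -
  let ?F = "binary_form (n + 1) a"
  have a: "a j \<noteq> 0" "a k \<noteq> 0" using assms(6) by auto
  obtain x y where xy: "(x, y) \<noteq> (0, 0)" "P = proj_point x y 0" "?F x y = 0"
    by (rule points_at_infinityE[OF assms(1) assms(7)[unfolded assms(2)]]) (rule that)
  have ne: "proj_point 1 0 0 \<noteq> proj_point 0 1 0" by (simp add: proj_point_eq_iff)
  show ?thesis
  proof (cases "x = 0")
    case True
    then have "P = proj_point 0 1 0"
      unfolding xy(2) using xy(1) by (intro proj_point_at_infinity_eqI) auto
    moreover have "?F 0 1 = 0"
      using xy(1,3) True binary_form_scale[of "n + 1" a y 0 1] by simp
    ultimately show ?thesis
      using ramification_number_y_direction_nonzero_iff[where a = a, OF assms(1,4,5) a(2), of h] ne[symmetric]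
      unfolding assms(2) by simp
  next
    case False
    define t0 where "t0 = y / x"
    have P: "P = proj_point 1 t0 0"
      unfolding xy(2) t0_def using False by (intro proj_point_at_infinity_eqI) auto
    have root: "?F 1 t0 = 0"
      using xy(3) False binary_form_scale[of "n + 1" a x 1 t0] by (simp add: t0_def)
    show ?thesis
    proof (cases "t0 = 0")
      case True
      then show ?thesis
        using ramification_number_x_direction_nonzero_iff[of j n a h] assms(3) a(1) ne root P
        unfolding assms(2) by simp
    next
      case False
      then have "P \<noteq> proj_point 1 0 0" "P \<noteq> proj_point 0 1 0"
        unfolding P by (auto simp: proj_point_eq_iff)
      moreover have "ramification_number H h P = 0"
        unfolding P assms(2) using assms(1,5) a(2) False root
        by (intro ramification_number_other_directions[where j = k]) auto
      ultimately show ?thesis by simp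
    qed
  qed
qed

end
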